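(* Let $A=\{t_n\}_{n=1}^\infty$ be any sequence of non-negative integers that dilates to infinity, i.e. $\lim_{n\to\infty}(t_{n+1}-t_n)=+\infty$. Then there is a rank one system $(X,\mathcal{B},\mu,T)$ such that $h^A(T)=+\infty$.
   Context: **Systems.** A measure-preserving system $(X,\mathcal{B},\mu,T)$ consists of a standard probability space and an invertible measure-preserving transformation $T$. Set equalities are modulo null sets. **Sequence entropy.** Let $f(0)=0$ and $f(x)=-x\log x$ for $x>0$. For a finite measurable partition $\xi=\{X_1,\dots,X_m\}$ put $H(\xi)=\sum_{i=1}^m f(\mu(X_i))$. For a sequence $A=\{t_n\}_{n\ge1}$ of non-negative integers put $$h^A(T,\xi)=\limsup_{n\to\infty}\frac1n H\Big(\bigvee_{k=1}^n T^{-t_k}\xi\Big),\qquad h^A(T)=\sup_\xi h^A(T,\xi),$$ the supremum being over all finite measurable partitions $\xi$ of $X$. **Rank one systems.** $(X,\mathcal{B},\mu,T)$ is a rank one system if there are integers $h_1\ge1$, $q_n\ge1$ ($n\ge1$) and $a_{n,i}\ge0$ ($n\ge1$, $1\le i\le q_n-1$) such that, with $a_n=\sum_{i=1}^{q_n-1}a_{n,i}$ and $h_{n+1}=q_nh_n+a_n$, the sequence $h_n$ is strictly increasing and $\sum_{n}a_n/h_{n+1}<\infty$, and measurable sets $F_n$ of positive measure such that for all $n\ge 1$: (a) $F_n,TF_n,\dots,T^{h_n-1}F_n$ are pairwise disjoint; their union is the tower $S_n$ with base $F_n$ and height $h_n$; (b) $F_n$ is partitioned into measurable sets $F_{n,1},\dots,F_{n,q_n}$;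 (c) $T^{h_n+a_{n,i}}F_{n,i}=F_{n,i+1}$ for $1\le i\le q_n-1$ (the sets $T^{h_n+j}F_{n,i}$, $0\le j<a_{n,i}$, are the spacer levels of $S_{n+1}$); (d) $F_{n+1}=F_{n,1}$; (e) the partitions $\xi_n=\{F_n,TF_n,\dots,T^{h_n-1}F_n,X\setminus S_n\}$ form a refining sequence converging to the partition into points (i.e. they generate $\mathcal{B}$ modulo null sets). *)

theory Defs
  imports "HOL-Analysis.Analysis" "HOL-Probability.Probability"
begin

text \<open>The Borel convention is used: the \<open>\<sigma>\<close>-algebra is not completed. As every such space is
  Borel isomorphic to a Borel subset of the real line, existence statements lose no generality
  when the point type is fixed to \<open>real\<close>.\<close>

definition standard_probability_space :: "'a measure \<Rightarrow> bool" where
  "standard_probability_space M \<longleftrightarrow> prob_space M \<and>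
     (\<exists>X. completely_metrizable_space X \<and> second_countable X \<and> topspace X = space M \<and>
          sets M = sigma_sets (topspace X) {U. openin X U})"

definition measure_preserving_system :: "'a measure \<Rightarrow> ('a \<Rightarrow> 'a) \<Rightarrow> bool" where
  "measure_preserving_system M T \<longleftrightarrow> standard_probability_space M \<and>
     bij_betw T (space M) (space M) \<and> T \<in> measurable M M \<and>
     the_inv_into (space M) T \<in> measurable M M \<and> distr M M T = M"

subsection \<open>Sequence entropy\<close>

definition ent_fun :: "real \<Rightarrow> real" where
  "ent_fun x = (if x = 0 then 0 else - x * ln x)"

definition finite_measurable_partition :: "'a measure \<Rightarrow> 'a set set \<Rightarrow> bool" where
  "finite_measurable_partition M \<xi> \<longleftrightarrow> finite \<xi> \<and> \<xi> \<subseteq> sets M \<and> partition_on (space M) \<xi>"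

definition partition_entropy :: "'a measure \<Rightarrow> 'a set set \<Rightarrow> real" where
  "partition_entropy M \<xi> = (\<Sum>B\<in>\<xi>. ent_fun (measure M B))"

definition pullback_partition :: "'a measure \<Rightarrow> ('a \<Rightarrow> 'a) \<Rightarrow> nat \<Rightarrow> 'a set set \<Rightarrow> 'a set set" where
  "pullback_partition M T j \<xi> = (\<lambda>B. (T ^^ j) -` B \<inter> space M) ` \<xi>"

text \<open>Sequences are indexed from 1; the value \<open>t 0\<close> is not used.\<close>

definition seq_entropy_partition ::
  "(nat \<Rightarrow> nat) \<Rightarrow> 'a measure \<Rightarrow> ('a \<Rightarrow> 'a) \<Rightarrow> 'a set set \<Rightarrow> ereal" where
  "seq_entropy_partition t M T \<xi> =
     limsup (\<lambda>n. ereal (1 / real n *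
       partition_entropy M (common_refinement ((\<lambda>k. pullback_partition M T (t k) \<xi>) ` {1..n}))))"

definition seq_entropy :: "(nat \<Rightarrow> nat) \<Rightarrow> 'a measure \<Rightarrow> ('a \<Rightarrow> 'a) \<Rightarrow> ereal" where
  "seq_entropy t M T =
     (SUP \<xi>\<in>{\<xi>. finite_measurable_partition M \<xi>}. seq_entropy_partition t M T \<xi>)"

subsection \<open>Rank one systems\<close>

definition null_subset :: "'a measure \<Rightarrow> 'a set \<Rightarrow> 'a set \<Rightarrow> bool" where
  "null_subset M A B \<longleftrightarrow> A - B \<in> null_sets M"

definition null_eq :: "'a measure \<Rightarrow> 'a set \<Rightarrow> 'a set \<Rightarrow> bool" where
  "null_eq M A B \<longleftrightarrow> null_subset M A B \<and> null_subset M B A"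

definition null_disjoint :: "'a measure \<Rightarrow> 'a set \<Rightarrow> 'a set \<Rightarrow> bool" where
  "null_disjoint M A B \<longleftrightarrow> A \<inter> B \<in> null_sets M"

definition tower :: "('a \<Rightarrow> 'a) \<Rightarrow> 'a set \<Rightarrow> nat \<Rightarrow> 'a set" where
  "tower T F h = (\<Union>j<h. (T ^^ j) ` F)"

definition tower_partition :: "'a measure \<Rightarrow> ('a \<Rightarrow> 'a) \<Rightarrow> 'a set \<Rightarrow> nat \<Rightarrow> 'a set set" where
  "tower_partition M T F h = insert (space M - tower T F h) ((\<lambda>j. (T ^^ j) ` F) ` {..<h})"

text \<open>All parameters are indexed from 1 in \<open>n\<close> and \<open>i\<close>; values at index 0 are irrelevant.
  The summability condition is therefore stated for the shifted sequence.\<close>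

definition rank_one_parameters ::
  "(nat \<Rightarrow> nat) \<Rightarrow> (nat \<Rightarrow> nat) \<Rightarrow> (nat \<Rightarrow> nat \<Rightarrow> nat) \<Rightarrow> bool" where
  "rank_one_parameters h q a \<longleftrightarrow>
     h 1 \<ge> 1 \<and> (\<forall>n\<ge>1. q n \<ge> 1) \<and>
     (\<forall>n\<ge>1. h (Suc n) = q n * h n + (\<Sum>i=1..<q n. a n i)) \<and>
     (\<forall>n\<ge>1. h n < h (Suc n)) \<and>
     summable (\<lambda>n. real (\<Sum>i=1..<q (Suc n). a (Suc n) i) / real (h (Suc (Suc n))))"

text \<open>\<open>F n\<close> is the base of the \<open>n\<close>-th tower and \<open>G n i\<close> is the \<open>i\<close>-th piece \<open>F\<^sub>n\<^sub>,\<^sub>i\<close> of \<open>F n\<close>.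
  Equalities, inclusions and disjointness are all modulo null sets.\<close>

definition rank_one_towers ::
  "'a measure \<Rightarrow> ('a \<Rightarrow> 'a) \<Rightarrow> (nat \<Rightarrow> nat) \<Rightarrow> (nat \<Rightarrow> nat) \<Rightarrow> (nat \<Rightarrow> nat \<Rightarrow> nat) \<Rightarrow>
   (nat \<Rightarrow> 'a set) \<Rightarrow> (nat \<Rightarrow> nat \<Rightarrow> 'a set) \<Rightarrow> bool" where
  "rank_one_towers M T h q a F G \<longleftrightarrow>
     (\<forall>n\<ge>1. F n \<in> sets M \<and> measure M (F n) > 0) \<and>
     (\<forall>n\<ge>1. \<forall>i<h n. \<forall>j<h n. i \<noteq> j \<longrightarrow> null_disjoint M ((T ^^ i) ` F n) ((T ^^ j) ` F n)) \<and>
     (\<forall>n\<ge>1. (\<forall>i\<in>{1..q n}. G n i \<in> sets M) \<and> null_eq M (F n) (\<Union>i\<in>{1..q n}. G n i) \<and>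
        (\<forall>i\<in>{1..q n}. \<forall>j\<in>{1..q n}. i \<noteq> j \<longrightarrow> null_disjoint M (G n i) (G n j))) \<and>
     (\<forall>n\<ge>1. \<forall>i\<in>{1..<q n}. null_eq M ((T ^^ (h n + a n i)) ` G n i) (G n (Suc i))) \<and>
     (\<forall>n\<ge>1. null_eq M (F (Suc n)) (G n 1)) \<and>
     (\<forall>n\<ge>1. \<forall>A\<in>tower_partition M T (F (Suc n)) (h (Suc n)).
        \<exists>B\<in>tower_partition M T (F n) (h n). null_subset M A B) \<and>
     (\<forall>B\<in>sets M. \<exists>C\<in>sigma_sets (space M) (\<Union>n\<in>{1..}. tower_partition M T (F n) (h n)).
        null_eq M B C)"

definition rank_one_system :: "'a measure \<Rightarrow> ('a \<Rightarrow> 'a) \<Rightarrow> bool" where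
  "rank_one_system M T \<longleftrightarrow> measure_preserving_system M T \<and>
     (\<exists>h q a F G. rank_one_parameters h q a \<and> rank_one_towers M T h q a F G)"

end

theory Submission
  imports Defs
begin

text \<open>The tower of stage \<open>n + 1\<close> is a concatenation of blocks of equal length \<open>(2\<^sup>n + 1) h\<^sub>n\<close>,
  closed by one more copy of the tower of stage \<open>n\<close> so that it ends without spacers. Each block
  consists of \<open>2\<^sup>n\<close> consecutive copies of the tower of stage \<open>n\<close>, preceded by \<open>s\<close> and followed by
  \<open>h\<^sub>n - s\<close> spacers, where the shifts \<open>s < h\<^sub>n\<close> of successive blocks run through all words of some
  large length. Continuing the periodic pattern of a block into its spacers assigns a virtual
  level of stage \<open>n\<close> to every position. As soon as the gaps of \<open>t\<close> exceed the block length, the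
  points \<open>T\<^bsup>t k\<^esup> x\<close> lie in different blocks, so their virtual levels are independent and uniformly
  distributed while \<open>x\<close> varies over most of the tower. Therefore the partition into the \<open>h\<^sub>m\<close> levels
  of stage \<open>m\<close>, extended to all later spacers through the virtual levels, has sequence entropy at
  least \<open>ln h\<^sub>m / 4 - 1\<close>, and \<open>h\<^sub>m\<close> is unbounded.\<close>

section \<open>Piecewise translations and partition entropy\<close>

text \<open>The obstacle is that \<open>t\<close> may grow arbitrarily fast, so no tower height
  fixed in advance is adapted to it. Since the entropy is a limsup, each stage has to serve a single
  \<open>N\<close> only: this \<open>N\<close> is fixed before the word length, which is then chosen
  larger than \<open>t N\<close>. Blocks have the same length whatever their shift, so the block
  visited at time \<open>t k\<close> depends on the starting position alone, and reading shifts
  becomes reading distinct letters of one word. A block has \<open>h n\<close> spacers against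
  \<open>2 ^ n\<close> copies of length \<open>h n\<close>; this ratio is summable, which keeps the
  total measure finite. Virtual levels are exactly uniform over all positions, spacers included, so
  descending from stage \<open>n\<close> to stage \<open>m\<close> produces classes of equal size.
  In the bound \<open>ln (h m) / 4 - 1\<close>, one factor 1/2 is the mass guaranteed for the light
  atoms, the other is the share of times at which the gaps are already large, and \<open>1\<close>
  absorbs a term \<open>ln 2\<close>.\<close>

lemma piecewise_translation_lborel:
  fixes T :: "real \<Rightarrow> real"
  assumes bij: "bij T" and D: "countable D" and TD: "\<And>x. T x - x \<in> D"
    and P: "\<And>d. d \<in> D \<Longrightarrow> {x. T x - x = d} \<in> sets borel"
  shows "T \<in> borel_measurable borel" "inv T \<in> borel_measurable borel"
    "distr lborel borel T = lborel"
proof -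
  define P' where "P' d = {x. T x - x = d}" for d
  have P'[measurable]: "P' d \<in> sets borel" if "d \<in> D" for d
    using P that by (simp add: P'_def)
  have pre: "T -` A = (\<Union>d\<in>D. P' d \<inter> ((+) d) -` A)" for A
    using TD by (force simp: P'_def algebra_simps)
  have pre_eq: "P' d \<inter> ((+) d) -` A = ((+) d) -` (T ` P' d \<inter> A)" for A d
    using bij by (force simp: P'_def bij_def inj_def algebra_simps image_iff)
  have im: "T ` A = (\<Union>d\<in>D. ((+) (-d)) -` (A \<inter> P' d))" for A
  proof -
    have "T x \<in> (\<Union>d\<in>D. ((+) (-d)) -` (A \<inter> P' d))" if "x \<in> A" for x
      using that TD[of x] by (intro UN_I[of "T x - x"]) (auto simp: P'_def)
    moreover have "y \<in> T ` A" if "y \<in> ((+) (-d)) -` (A \<inter> P' d)" for y d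
    proof -
      have "y - d \<in> A" "T (y - d) = y"
        using that by (auto simp: P'_def algebra_simps)
      then show ?thesis by force
    qed
    ultimately show ?thesis by blast
  qed
  have meas_vimage: "((+) d) -` B \<in> sets borel" if "B \<in> sets borel" for B and d :: real
    using measurable_sets[of "(+) d" borel borel B] that by simp
  have pre_meas: "T -` A \<in> sets borel" if [measurable]: "A \<in> sets borel" for A
    unfolding pre using D meas_vimage[OF that] by (intro sets.countable_UN') auto
  have im_meas: "T ` A \<in> sets borel" if [measurable]: "A \<in> sets borel" for A
    unfolding im using D by (intro sets.countable_UN' meas_vimage) auto
  show T[measurable]: "T \<in> borel_measurable borel"
    using pre_meas by (intro measurableI) auto
  show "inv T \<in> borel_measurable borel"
    using im_meas bij by (intro measurableI) (auto simp: bij_vimage_eq_inv_image bij_imp_bij_inv inv_inv_eq)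
  have transl: "emeasure lborel (((+) d) -` B) = emeasure lborel B" if "B \<in> sets borel" for B and d :: real
  proof -
    have "emeasure lborel B = emeasure (distr lborel borel ((+) d)) B"
      by (simp add: lborel_distr_plus)
    also have "\<dots> = emeasure lborel (((+) d) -` B)"
      using that by (subst emeasure_distr) auto
    finally show ?thesis ..
  qed
  show "distr lborel borel T = lborel"
  proof (rule measure_eqI)
    fix A assume "A \<in> sets (distr lborel borel T)"
    then have A[measurable]: "A \<in> sets borel" by simp
    have "emeasure (distr lborel borel T) A = emeasure lborel (T -` A)"
      by (subst emeasure_distr) auto
    also have "\<dots> = (\<integral>\<^sup>+d. emeasure lborel (P' d \<inter> ((+) d) -` A) \<partial>count_space D)"
      unfolding pre using D meas_vimage[OF A]
      by (intro emeasure_UN_countable) (auto simp: disjoint_family_on_def P'_def)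
    also have "\<dots> = (\<integral>\<^sup>+d. emeasure lborel (T ` P' d \<inter> A) \<partial>count_space D)"
    proof (intro nn_integral_cong)
      fix d assume "d \<in> space (count_space D)"
      then have "T ` P' d \<inter> A \<in> sets borel" using im_meas by auto
      then show "emeasure lborel (P' d \<inter> ((+) d) -` A) = emeasure lborel (T ` P' d \<inter> A)"
        unfolding pre_eq by (rule transl)
    qed
    also have "\<dots> = emeasure lborel (\<Union>d\<in>D. T ` P' d \<inter> A)"
      using D im_meas bij by (intro emeasure_UN_countable[symmetric])
        (auto simp: disjoint_family_on_def P'_def bij_def inj_def)
    also have "(\<Union>d\<in>D. T ` P' d \<inter> A) = A"
    proof -
      have "\<exists>d\<in>D. y \<in> T ` P' d" for y
      proof -
        obtain x where "y = T x" using bij by (metis bij_pointE)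
        then show ?thesis using TD[of x] by (auto simp: P'_def)
      qed
      then show ?thesis by blast
    qed
    finally show "emeasure (distr lborel borel T) A = emeasure lborel A" .
  qed simp
qed

text \<open>The atoms heavier than \<open>2 \<delta>\<close> meet \<open>G\<close> in less than half of their mass, so together
  they carry at most twice the mass missing from \<open>G\<close>.\<close>

lemma partition_entropy_ge:
  assumes "prob_space M" and fin: "finite P" and sets: "P \<subseteq> sets M"
    and part: "partition_on (space M) P" and G[measurable]: "G \<in> sets M"
    and G_ge: "measure M G \<ge> 3/4" and \<delta>: "0 < \<delta>" "2 * \<delta> \<le> 1"
    and small: "\<And>A. A \<in> P \<Longrightarrow> measure M (A \<inter> G) \<le> \<delta>"
  shows "partition_entropy M P \<ge> ln (1 / (2 * \<delta>)) / 2"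
proof -
  interpret prob_space M by fact
  have sum_inter: "(\<Sum>A\<in>P. prob (A \<inter> E)) = prob E" if [measurable]: "E \<in> events" for E
  proof -
    have "A \<inter> B = {}" if "A \<in> P" "B \<in> P" "A \<noteq> B" for A B
      using part that by (auto simp: partition_on_def dest: disjointD)
    then have "(\<Sum>A\<in>P. prob (A \<inter> E)) = prob (\<Union>A\<in>P. A \<inter> E)"
      using sets fin
      by (intro finite_measure_finite_Union[symmetric]) (fastforce simp: disjoint_family_on_def)+
    also have "(\<Union>A\<in>P. A \<inter> E) = E"
      using part sets.sets_into_space[OF that] by (auto simp: partition_on_def)
    finally show ?thesis .
  qed
  have sum_all: "(\<Sum>A\<in>P. prob A) = 1"
  proof -
    have "(\<Sum>A\<in>P. prob A) = (\<Sum>A\<in>P. prob (A \<inter> space M))"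
      using sets by (intro sum.cong) (auto simp: subset_iff)
    then show ?thesis
      using sum_inter[of "space M"] by (simp add: prob_space)
  qed
  define B where "B = {A\<in>P. prob A > 2 * \<delta>}"
  have "(\<Sum>A\<in>B. prob A) \<le> (\<Sum>A\<in>B. 2 * (prob A - prob (A \<inter> G)))"
    using small by (intro sum_mono) (force simp: B_def)
  also have "\<dots> \<le> (\<Sum>A\<in>P. 2 * (prob A - prob (A \<inter> G)))"
    using sets fin by (intro sum_mono2) (auto simp: B_def intro!: finite_measure_mono)
  also have "\<dots> = 2 * (1 - prob G)"
    using sum_inter[OF G] sum_all by (simp add: sum_subtractf flip: sum_distrib_left)
  also have "\<dots> \<le> 1 / 2"
    using G_ge by simp
  finally have "(\<Sum>A\<in>B. prob A) \<le> 1 / 2" .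
  moreover have "(\<Sum>A\<in>P. prob A) = (\<Sum>A\<in>B. prob A) + (\<Sum>A\<in>P - B. prob A)"
    using fin by (subst sum.subset_diff[of B]) (auto simp: B_def)
  ultimately have light: "(\<Sum>A\<in>P - B. prob A) \<ge> 1 / 2"
    using sum_all by simp
  \<comment> \<open>The hypothesis \<open>2 * \<delta> \<le> 1\<close> makes the logarithm
    non-negative, so the light mass may be replaced by its lower bound 1/2.\<close>
  have "ln (1 / (2 * \<delta>)) / 2 \<le> (\<Sum>A\<in>P - B. prob A) * ln (1 / (2 * \<delta>))"
    using mult_right_mono[OF light, of "ln (1 / (2 * \<delta>))"] \<delta> by simp
  also have "\<dots> = (\<Sum>A\<in>P - B. prob A * ln (1 / (2 * \<delta>)))"
    by (simp add: sum_distrib_right)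
  also have "\<dots> \<le> (\<Sum>A\<in>P - B. ent_fun (prob A))"
  proof (intro sum_mono)
    fix A assume A: "A \<in> P - B"
    show "prob A * ln (1 / (2 * \<delta>)) \<le> ent_fun (prob A)"
    proof (cases "prob A = 0")
      case False
      then have "0 < prob A" by (simp add: less_le)
      moreover have "prob A \<le> 2 * \<delta>" using A by (auto simp: B_def)
      ultimately have "ln (prob A) \<le> ln (2 * \<delta>)" using \<delta> by simp
      then have "prob A * - ln (2 * \<delta>) \<le> prob A * - ln (prob A)"
        by (intro mult_left_mono) auto
      then show ?thesis using False \<delta> by (simp add: ent_fun_def ln_div)
    qed (simp add: ent_fun_def)
  qed
  also have "\<dots> \<le> (\<Sum>A\<in>P. ent_fun (prob A))"
    using fin by (intro sum_mono2)
      (auto simp: ent_fun_def less_le intro!: mult_nonneg_nonpos ln_le_zero_iff[THEN iffD2])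
  finally show ?thesis
    by (simp add: partition_entropy_def)
qed

section \<open>Independent block shifts\<close>

text \<open>As the shift \<open>y\<close> runs through all values below \<open>h\<close>, the
  virtual level of a fixed position takes every residue exactly once: a uniform shift gives a
  uniform virtual level. The summand \<open>h\<close> keeps the subtraction of naturals from
  truncating.\<close>

lemma bij_betw_reflect_mod:
  fixes a h :: nat
  shows "bij_betw (\<lambda>y. (a + h - y) mod h) {..<h} {..<h}"
proof -
  have "inj_on (\<lambda>y. (a + h - y) mod h) {..<h}"
  proof (rule linorder_inj_onI)
    fix x y assume xy: "x < y" "x \<in> {..<h}" "y \<in> {..<h}"
    have "\<not> h dvd (y - x)" using xy by (auto dest: dvd_imp_le)
    moreover have "(a + h - x) - (a + h - y) = y - x" using xy by auto
    ultimately show "(a + h - x) mod h \<noteq> (a + h - y) mod h"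
      using xy mod_eq_dvd_iff_nat[of "a + h - y" "a + h - x" h] by auto
  qed auto
  moreover have "(\<lambda>y. (a + h - y) mod h) ` {..<h} \<subseteq> {..<h}"
    by auto
  ultimately show ?thesis
    by (simp add: bij_betw_def endo_inj_surj)
qed

text \<open>Independence in counting form: the constrained coordinates are distinct, so the
  admissible words form a box and each constraint divides their number by exactly \<open>K\<close>.
  Multiplying out avoids division of naturals.\<close>

lemma card_PiE_constrained:
  fixes i :: "'k \<Rightarrow> nat"
  assumes "finite I" and inj: "inj_on i I" and i: "i ` I \<subseteq> {..<R}"
    and E: "\<And>k. k \<in> I \<Longrightarrow> E k \<subseteq> {..<h} \<and> card (E k) = g" and gK: "g * K = h"
  shows "card {f \<in> {..<R} \<rightarrow>\<^sub>E {..<h}. \<forall>k\<in>I. f (i k) \<in> E k} * K ^ card I = h ^ R"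
proof -
  define C where "C x = (if x \<in> i ` I then E (inv_into I i x) else {..<h})" for x
  have "{f \<in> {..<R} \<rightarrow>\<^sub>E {..<h}. \<forall>k\<in>I. f (i k) \<in> E k} = Pi\<^sub>E {..<R} C"
  proof (intro equalityI subsetI)
    fix f assume "f \<in> {f \<in> {..<R} \<rightarrow>\<^sub>E {..<h}. \<forall>k\<in>I. f (i k) \<in> E k}"
    then show "f \<in> Pi\<^sub>E {..<R} C"
      using inj by (auto simp: C_def PiE_iff split: if_splits)
  next
    fix f assume f: "f \<in> Pi\<^sub>E {..<R} C"
    have "f x < h" if "x < R" for x
    proof -
      have fx: "f x \<in> C x" using f that by (auto simp: PiE_iff)
      show ?thesis
      proof (cases "x \<in> i ` I")
        case True
        then have "f x \<in> E (inv_into I i x)" "inv_into I i x \<in> I"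
          using fx by (simp_all add: C_def inv_into_into)
        then show ?thesis using E by blast
      qed (use fx in \<open>simp add: C_def\<close>)
    qed
    moreover have "f (i k) \<in> E k" if "k \<in> I" for k
    proof -
      have "i k < R" using that i by auto
      then have "f (i k) \<in> C (i k)" using f by (auto simp: PiE_iff)
      then show ?thesis using that inj by (simp add: C_def)
    qed
    ultimately show "f \<in> {f \<in> {..<R} \<rightarrow>\<^sub>E {..<h}. \<forall>k\<in>I. f (i k) \<in> E k}"
      using f by (simp add: PiE_iff)
  qed
  then have "card {f \<in> {..<R} \<rightarrow>\<^sub>E {..<h}. \<forall>k\<in>I. f (i k) \<in> E k} = (\<Prod>x<R. card (C x))"
    by (simp add: card_PiE)
  also have "\<dots> = (\<Prod>x\<in>{..<R} - i ` I. card (C x)) * (\<Prod>x\<in>i ` I. card (C x))"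
    using i by (intro prod.subset_diff) auto
  also have "(\<Prod>x\<in>{..<R} - i ` I. card (C x)) = h ^ (R - card I)"
    using i assms(1) by (simp add: C_def card_Diff_subset card_image[OF inj])
  also have "(\<Prod>x\<in>i ` I. card (C x)) = g ^ card I"
    using inj E by (simp add: prod.reindex C_def)
  finally have "card {f \<in> {..<R} \<rightarrow>\<^sub>E {..<h}. \<forall>k\<in>I. f (i k) \<in> E k} * K ^ card I
      = h ^ (R - card I) * (g * K) ^ card I"
    by (simp add: power_mult_distrib)
  moreover have "card I \<le> R"
    using i card_mono[of "{..<R}" "i ` I"] by (simp add: card_image[OF inj])
  ultimately show ?thesis
    by (simp add: gK flip: power_add)
qed

text \<open>In block \<open>p div l\<close> the copies are displaced by the shift of that block. The
  offset of the block itself vanishes modulo \<open>h\<close>, because \<open>l\<close> will be a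
  multiple of \<open>h\<close>. Adding \<open>h\<close> first prevents truncation, as shifts are
  below \<open>h\<close>.\<close>

definition virtual_level :: "nat \<Rightarrow> nat \<Rightarrow> (nat \<Rightarrow> nat) \<Rightarrow> nat \<Rightarrow> nat" where
  "virtual_level h l s p = (p + h - s (p div l)) mod h"

text \<open>The shifts of consecutive blocks spell out, one after the other, all words of length
  \<open>R\<close> over \<open>{..<h}\<close>. If \<open>p\<close> lies in \<open>G\<close>, the blocks visited at the times \<open>p + t k\<close>, \<open>m < k \<le> N\<close>,
  are distinct and belong to the same word, which makes the virtual levels independent.\<close>

lemma ex_independent_shifts:
  fixes t :: "nat \<Rightarrow> nat"
  assumes t: "filterlim (\<lambda>n. int (t (Suc n)) - int (t n)) at_top sequentially"
    and h: "0 < h" and l: "l = c * h" "0 < c"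
  shows "\<exists>Q s m N G. 0 < Q \<and> s 0 = 0 \<and> s Q = 0 \<and> (\<forall>J. s J < h) \<and> 2 * m + n < N \<and>
    G \<subseteq> {..<Q * l + h} \<and> 7 * (Q * l + h) \<le> 8 * card G \<and>
    (\<forall>p\<in>G. \<forall>k\<in>{m<..N}. p + t k < Q * l + h) \<and>
    (\<forall>B g K. g * K = h \<longrightarrow> (\<forall>k\<in>{m<..N}. B k \<subseteq> {..<h} \<and> card (B k) = g) \<longrightarrow>
      card {p\<in>G. \<forall>k\<in>{m<..N}. virtual_level h l s (p + t k) \<in> B k} * K ^ (N - m) = card G)"
proof -
  have "l > 0" using h l by simp
  have "\<forall>\<^sub>F k in sequentially. int l \<le> int (t (Suc k)) - int (t k)"
    using t by (simp add: filterlim_at_top)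
  then obtain m where "\<And>k. m \<le> k \<Longrightarrow> int l \<le> int (t (Suc k)) - int (t k)"
    by (auto simp: eventually_sequentially)
  then have gap: "t k + l \<le> t (Suc k)" if "m \<le> k" for k
    using that by (metis add.commute le_diff_eq of_nat_add of_nat_le_iff)
  have gap': "t k + l \<le> t k'" if "m \<le> k" "k < k'" for k k'
    using that(2,1)
  proof (induction k')
    case (Suc k')
    show ?case
    proof (cases "k < k'")
      case True
      then show ?thesis using Suc gap[of k'] by simp
    next
      case False
      then have "k' = k" using Suc.prems by simp
      then show ?thesis using gap Suc.prems by simp
    qed
  qed simp
  \<comment> \<open>More than half of the times up to \<open>N\<close> lie beyond \<open>m\<close>,
    where the gaps are at least \<open>l\<close>, and \<open>n < N\<close> makes these
    \<open>N\<close> unbounded over the stages.\<close>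
  define N where "N = 2 * m + n + 1"
  \<comment> \<open>A visited block is fewer than \<open>D\<close> blocks ahead of the starting one,
    so a starting slot \<open>v \<le> R - D\<close> keeps all visited blocks inside one word. This
    loses less than 1/64 of the slots; the fraction 7/8 leaves room for block \<open>0\<close> and
    the closing copy.\<close>
  define D where "D = t N + 1"
  define R where "R = 64 * D"
  define Q where "Q = 1 + R * h ^ R"
  have "D > 0" by (simp add: D_def)
  then have "R > 0" by (simp add: R_def)
  have "card ({..<R} \<rightarrow>\<^sub>E {..<h}) = h ^ R" by (simp add: card_PiE)
  then obtain e where e: "bij_betw e {..<h ^ R} ({..<R} \<rightarrow>\<^sub>E {..<h})"
    by (metis ex_bij_betw_nat_finite finite_PiE finite_lessThan atLeast0LessThan)
  \<comment> \<open>Block \<open>0\<close> is the unshifted one demanded by \<open>s 0 = 0\<close>;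
    block \<open>1 + u * R + v\<close> carries letter \<open>v\<close> of word \<open>u\<close>. The
    default \<open>0\<close> provides \<open>s Q = 0\<close>.\<close>
  define s where "s J = (if 1 \<le> J \<and> J < Q then e ((J - 1) div R) ((J - 1) mod R) else 0)" for J
  have e_less: "e u v < h" if "u < h ^ R" "v < R" for u v
    using bij_betwE[OF e] that by (fastforce simp: PiE_iff)
  have s_word: "s (1 + u * R + v) = e u v" if "u < h ^ R" "v < R" for u v
  proof -
    have "u * R + v < Suc u * R" using that by simp
    also have "Suc u * R \<le> h ^ R * R" using that(1) by (intro mult_le_mono1) simp
    finally show ?thesis using that by (simp add: s_def Q_def mult.commute)
  qed
  have s_less: "s J < h" for J
  proof (cases "1 \<le> J \<and> J < Q")
    case True
    then have "(J - 1) div R < h ^ R" by (auto simp: Q_def less_mult_imp_div_less mult.commute)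
    then show ?thesis using True e_less \<open>R > 0\<close> by (auto simp: s_def)
  qed (use h in \<open>auto simp: s_def\<close>)
  \<comment> \<open>Coordinates of a starting position: slot \<open>v\<close> in the word, offset
    \<open>\<rho>\<close> in the block, word \<open>u\<close>. Once \<open>v\<close> and
    \<open>\<rho>\<close> are fixed, so are the slots visited at all times, and only the word still
    varies.\<close>
  define P where "P = (\<lambda>(v, \<rho>, u). (1 + u * R + v) * l + \<rho>)"
  define S where "S = {..R - D} \<times> {..<l} \<times> {..<h ^ R}"
  define G where "G = P ` S"
  have vR: "v < R" if "v \<le> R - D" for v using that \<open>D > 0\<close> \<open>R > 0\<close> by linarith
  have inj: "inj_on P S"
  proof (rule inj_onI)
    fix x y assume x: "x \<in> S" and y: "y \<in> S" and eq: "P x = P y"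
    obtain v \<rho> u v' \<rho>' u' where [simp]: "x = (v, \<rho>, u)" "y = (v', \<rho>', u')" by (cases x, cases y)
    have \<rho>: "\<rho> < l" "\<rho>' < l" and "v < R" "v' < R" using x y vR by (auto simp: S_def)
    have "(1 + u * R + v) * l + \<rho> = (1 + u' * R + v') * l + \<rho>'"
      using eq by (simp add: P_def)
    then have "\<rho> = \<rho>'" and "1 + u * R + v = 1 + u' * R + v'"
      using \<rho> by (metis mod_mult_self3 mod_less, metis div_mult_self3 div_less add_0_right \<open>l > 0\<close> less_not_refl)
    moreover from this have "v = v'" "u = u'"
      using \<open>v < R\<close> \<open>v' < R\<close> by (metis add_left_cancel mod_mult_self3 mod_less add.assoc,
        metis add_left_cancel div_mult_self3 div_less add_0_right \<open>R > 0\<close> less_not_refl add.assoc)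
    ultimately show "x = y" by simp
  qed
  have card_G: "card G = Suc (R - D) * (l * h ^ R)"
    unfolding G_def card_image[OF inj] by (simp add: S_def card_cartesian_product)
  have decomp: "P (v, \<rho>, u) + t k = (1 + u * R + (v + (\<rho> + t k) div l)) * l + (\<rho> + t k) mod l"
    for v \<rho> u k
    by (simp add: P_def algebra_simps)
  have bound: "v + (\<rho> + t k) div l < R"
    if "v \<le> R - D" "\<rho> < l" "k \<in> {m<..N}" for v \<rho> k
  proof -
    have "t k \<le> t N" using that gap'[of k N] by (cases "k = N") auto
    have "(\<rho> + t k) div l \<le> t k"
    proof (cases "t k")
      case 0 then show ?thesis using that by simp
    next
      case (Suc j)
      have "t k \<le> l * t k" using \<open>l > 0\<close> by simp
      then have "\<rho> + t k < l * t k + l" using that(2) by linarith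
      then have "\<rho> + t k < l * (t k + 1)" by simp
      then show ?thesis by (metis Suc_eq_plus1 less_Suc_eq_le less_mult_imp_div_less mult.commute)
    qed
    then show ?thesis using that \<open>t k \<le> t N\<close> \<open>D > 0\<close> by (simp add: D_def R_def)
  qed
  have vl: "virtual_level h l s (P (v, \<rho>, u) + t k) = (\<rho> + t k + h - e u (v + (\<rho> + t k) div l)) mod h"
    if "v \<le> R - D" "\<rho> < l" "u < h ^ R" "k \<in> {m<..N}" for v \<rho> u k
  proof -
    define J where "J = 1 + u * R + (v + (\<rho> + t k) div l)"
    have sJ: "s J = e u (v + (\<rho> + t k) div l)"
      using that bound[of v \<rho> k] s_word[of u "v + (\<rho> + t k) div l"] by (simp add: J_def)
    have 1: "P (v, \<rho>, u) + t k = (1 + u * R + v) * l + (\<rho> + t k)"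
      by (simp add: P_def)
    have 2: "(P (v, \<rho>, u) + t k) div l = J"
      using \<open>l > 0\<close> unfolding 1 J_def by (subst div_mult_self3) auto
    have "P (v, \<rho>, u) + t k + h - s J = ((1 + u * R + v) * c) * h + (\<rho> + t k + h - s J)"
      using s_less[of J] unfolding 1 l by (simp add: algebra_simps)
    then show ?thesis
      unfolding virtual_level_def 2 by (simp add: sJ)
  qed
  have inside: "p + t k < Q * l + h" if pG: "p \<in> G" and k: "k \<in> {m<..N}" for p k
  proof -
    obtain v \<rho> u where p: "p = P (v, \<rho>, u)" "v \<le> R - D" "\<rho> < l" "u < h ^ R"
    proof (atomize_elim)
      obtain x where x: "x \<in> S" "p = P x" using pG unfolding G_def by blast
      obtain v \<rho> u where "x = (v, \<rho>, u)" by (cases x)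
      then show "\<exists>v \<rho> u. p = P (v, \<rho>, u) \<and> v \<le> R - D \<and> \<rho> < l \<and> u < h ^ R"
        using x by (auto simp: S_def)
    qed
    have "u * R + (v + (\<rho> + t k) div l) < Suc u * R" using bound[OF p(2,3) k] by simp
    also have "Suc u * R \<le> h ^ R * R" using p(4) by (intro mult_le_mono1) simp
    finally have "Suc (1 + u * R + (v + (\<rho> + t k) div l)) \<le> Q" by (simp add: Q_def mult.commute)
    then have "Suc (1 + u * R + (v + (\<rho> + t k) div l)) * l \<le> Q * l" by (rule mult_le_mono1)
    moreover have "(\<rho> + t k) mod l < l" using \<open>l > 0\<close> by simp
    ultimately show ?thesis unfolding p(1) decomp by simp
  qed
  have "7 * (Q * l + h) \<le> 8 * card G"
  proof -
    define X where "X = D * h ^ R"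
    have "1 \<le> X" using \<open>D > 0\<close> h by (simp add: X_def Suc_leI)
    have "h \<le> l" using l h by simp
    then have "7 * (Q * l + h) \<le> 7 * (2 + 64 * X) * l"
      by (simp add: Q_def R_def X_def algebra_simps)
    also have "\<dots> \<le> 8 * (63 * X) * l" using \<open>1 \<le> X\<close> by (intro mult_le_mono1) simp
    also have "\<dots> \<le> 8 * card G"
      unfolding card_G by (simp add: R_def X_def algebra_simps)
    finally show ?thesis .
  qed
  moreover have "card {p\<in>G. \<forall>k\<in>{m<..N}. virtual_level h l s (p + t k) \<in> B k} * K ^ (N - m) = card G"
    if gK: "g * K = h" and B: "\<forall>k\<in>{m<..N}. B k \<subseteq> {..<h} \<and> card (B k) = g" for B g K
  proof -
    define U where "U v \<rho> = {u\<in>{..<h ^ R}. \<forall>k\<in>{m<..N}. (\<rho> + t k + h - e u (v + (\<rho> + t k) div l)) mod h \<in> B k}" for v \<rho>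
    have card_U: "card (U v \<rho>) * K ^ (N - m) = h ^ R" if v: "v \<le> R - D" and \<rho>: "\<rho> < l" for v \<rho>
    proof -
      \<comment> \<open>The condition on the virtual level at time \<open>k\<close>, turned into one
        on the shift. Reflection modulo \<open>h\<close> is bijective, so \<open>E k\<close> is as
        large as \<open>B k\<close>.\<close>
      define E where "E k = {y\<in>{..<h}. (\<rho> + t k + h - y) mod h \<in> B k}" for k
      define i where "i k = v + (\<rho> + t k) div l" for k
      have "bij_betw e (U v \<rho>) {f \<in> {..<R} \<rightarrow>\<^sub>E {..<h}. \<forall>k\<in>{m<..N}. f (i k) \<in> E k}"
      proof -
        have "e ` U v \<rho> = {f \<in> {..<R} \<rightarrow>\<^sub>E {..<h}. \<forall>k\<in>{m<..N}. f (i k) \<in> E k}"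
        proof (intro equalityI subsetI)
          fix f assume "f \<in> e ` U v \<rho>"
          then obtain u where u: "u \<in> U v \<rho>" "f = e u" by auto
          then show "f \<in> {f \<in> {..<R} \<rightarrow>\<^sub>E {..<h}. \<forall>k\<in>{m<..N}. f (i k) \<in> E k}"
            using bij_betwE[OF e] bound[OF v \<rho>] e_less by (auto simp: U_def E_def i_def)
        next
          fix f assume f: "f \<in> {f \<in> {..<R} \<rightarrow>\<^sub>E {..<h}. \<forall>k\<in>{m<..N}. f (i k) \<in> E k}"
          then obtain u where "u < h ^ R" "f = e u"
            using bij_betw_imp_surj_on[OF e] by blast
          then show "f \<in> e ` U v \<rho>" using f by (auto simp: U_def E_def i_def)
        qed
        then show ?thesis
          using e by (auto simp: bij_betw_def U_def intro: inj_on_subset)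
      qed
      then have "card (U v \<rho>) = card {f \<in> {..<R} \<rightarrow>\<^sub>E {..<h}. \<forall>k\<in>{m<..N}. f (i k) \<in> E k}"
        by (rule bij_betw_same_card)
      moreover have "card {f \<in> {..<R} \<rightarrow>\<^sub>E {..<h}. \<forall>k\<in>{m<..N}. f (i k) \<in> E k} * K ^ card {m<..N} = h ^ R"
      proof (rule card_PiE_constrained[OF _ _ _ _ gK])
        show "inj_on i {m<..N}"
        proof (rule linorder_inj_onI)
          fix k k' assume k: "k < k'" "k \<in> {m<..N}" "k' \<in> {m<..N}"
          \<comment> \<open>A gap of at least \<open>l\<close> moves the visited slot strictly
            forward, so distinct times read distinct letters.\<close>
          have "(\<rho> + t k) div l < (\<rho> + t k + l) div l" using \<open>l > 0\<close> by simp
          also have "\<dots> \<le> (\<rho> + t k') div l" using gap'[of k k'] k by (intro div_le_mono) simp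
          finally show "i k \<noteq> i k'" by (simp add: i_def)
        qed auto
        show "i ` {m<..N} \<subseteq> {..<R}" using bound[OF v \<rho>] by (auto simp: i_def)
        fix k assume k: "k \<in> {m<..N}"
        have "bij_betw (\<lambda>y. (\<rho> + t k + h - y) mod h) (E k) (B k)"
        proof -
          have "b \<in> (\<lambda>y. (\<rho> + t k + h - y) mod h) ` E k" if "b \<in> B k" for b
          proof -
            have "b \<in> (\<lambda>y. (\<rho> + t k + h - y) mod h) ` {..<h}"
              unfolding bij_betw_imp_surj_on[OF bij_betw_reflect_mod] using B k that by blast
            then obtain y where "y < h" "b = (\<rho> + t k + h - y) mod h" by blast
            then show ?thesis using that unfolding E_def by blast
          qed
          then have "(\<lambda>y. (\<rho> + t k + h - y) mod h) ` E k = B k"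
            unfolding E_def by blast
          moreover have "E k \<subseteq> {..<h}" unfolding E_def by blast
          ultimately show ?thesis
            by (intro bij_betw_subset[OF bij_betw_reflect_mod])
        qed
        then show "E k \<subseteq> {..<h} \<and> card (E k) = g"
          using B k bij_betw_same_card by (fastforce simp: E_def)
      qed simp
      ultimately show ?thesis by simp
    qed
    have "{p\<in>G. \<forall>k\<in>{m<..N}. virtual_level h l s (p + t k) \<in> B k}
        = P ` {x\<in>S. \<forall>k\<in>{m<..N}. virtual_level h l s (P x + t k) \<in> B k}"
      by (auto simp: G_def)
    moreover have "{x\<in>S. \<forall>k\<in>{m<..N}. virtual_level h l s (P x + t k) \<in> B k}
        = (SIGMA v:{..R - D}. SIGMA \<rho>:{..<l}. U v \<rho>)"
      by (auto simp: S_def U_def vl)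
    moreover have "inj_on P {x\<in>S. \<forall>k\<in>{m<..N}. virtual_level h l s (P x + t k) \<in> B k}"
      by (rule inj_on_subset[OF inj]) auto
    ultimately have "card {p\<in>G. \<forall>k\<in>{m<..N}. virtual_level h l s (p + t k) \<in> B k}
        = (\<Sum>v\<le>R - D. \<Sum>\<rho><l. card (U v \<rho>))"
      by (simp add: card_image card_SigmaI U_def)
    then have "card {p\<in>G. \<forall>k\<in>{m<..N}. virtual_level h l s (p + t k) \<in> B k} * K ^ (N - m)
        = (\<Sum>v\<le>R - D. \<Sum>\<rho><l. card (U v \<rho>) * K ^ (N - m))"
      by (simp add: sum_distrib_right)
    also have "\<dots> = (\<Sum>v\<le>R - D. \<Sum>\<rho><l. h ^ R)"
      by (intro sum.cong refl card_U) auto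
    finally show ?thesis by (simp add: card_G)
  qed
  moreover have "G \<subseteq> {..<Q * l + h}"
  proof
    fix p assume "p \<in> G"
    then show "p \<in> {..<Q * l + h}" using inside[of p N] by (auto simp: N_def)
  qed
  moreover have "0 < Q" "s 0 = 0" "s Q = 0" "2 * m + n < N" by (auto simp: Q_def s_def N_def)
  ultimately show ?thesis
    using s_less inside by (intro exI[of _ Q] exI[of _ s] exI[of _ m] exI[of _ N] exI[of _ G]) blast
qed

section \<open>Cutting and stacking on the real line\<close>

text \<open>\<open>pos n b\<close> is the height in tower \<open>n + 1\<close> at which copy
  \<open>b\<close> of tower \<open>n\<close> begins. \<open>pos_0\<close> and
  \<open>pos_last\<close> forbid spacers below the first and above the last copy.
  \<open>h_bounded\<close> keeps the Lebesgue measure of the towers bounded, since the product is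
  the reciprocal of the level width.\<close>

locale cutting_and_stacking =
  fixes h q :: "nat \<Rightarrow> nat" and pos :: "nat \<Rightarrow> nat \<Rightarrow> nat"
  assumes h_0: "0 < h 0" and q_ge_2: "2 \<le> q n"
    and pos_0: "pos n 0 = 0"
    and pos_Suc: "Suc b < q n \<Longrightarrow> pos n b + h n \<le> pos n (Suc b)"
    and pos_last: "pos n (q n - 1) + h n = h (Suc n)"
    and h_bounded: "\<exists>C. \<forall>n. real (h n) \<le> C * (\<Prod>m<n. real (q m))"
begin

lemma q_pos: "0 < q n"
  using q_ge_2[of n] by simp

lemma pos_less: "b < b' \<Longrightarrow> b' < q n \<Longrightarrow> pos n b + h n \<le> pos n b'"
proof (induction b')
  case (Suc b')
  then show ?case using pos_Suc[of b' n] by (cases "b = b'") auto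
qed simp

lemma pos_le: "b < q n \<Longrightarrow> pos n b + h n \<le> h (Suc n)"
  using pos_less[of b "q n - 1" n] pos_last[of n] by (cases "b < q n - 1") (auto simp: not_less dest: order_antisym[of _ b])

lemma h_less_Suc: "h n < h (Suc n)" and h_pos: "0 < h n"
proof -
  have less: "0 < h n \<Longrightarrow> h n < h (Suc n)" for n
    using q_ge_2[of n] pos_less[of 0 1 n] pos_le[of 1 n] by (auto simp: pos_0)
  have "0 < h n" for n
    by (induction n) (use h_0 less in \<open>auto intro: less_trans\<close>)
  then show "h n < h (Suc n)" "0 < h n" using less by auto
qed

lemma strict_mono_h: "strict_mono h"
  by (simp add: strict_mono_Suc_iff h_less_Suc)

lemma pos_add_less: "b < q n \<Longrightarrow> j < h n \<Longrightarrow> pos n b + j < h (Suc n)"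
  using pos_le[of b n] by linarith

lemma copy_unique:
  assumes "pos n b + j = pos n b' + j'" "b < q n" "b' < q n" "j < h n" "j' < h n"
  shows "b = b' \<and> j = j'"
proof -
  have "b = b'"
    using assms pos_less[of b b' n] pos_less[of b' b n] by (cases b b' rule: linorder_cases) auto
  then show ?thesis using assms by simp
qed

section \<open>Levels as half-open intervals\<close>

definition width :: "nat \<Rightarrow> real" where
  "width n = 1 / (\<Prod>m<n. real (q m))"

lemma width_0 [simp]: "width 0 = 1"
  by (simp add: width_def)

lemma width_pos [simp]: "0 < width n"
  using q_pos by (simp add: width_def prod_pos)

lemma width_Suc: "real (q n) * width (Suc n) = width n"
  using q_pos[of n] by (simp add: width_def)

lemma width_le: "width n \<le> (1 / 2) ^ n"
proof (induction n)
  case (Suc n)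
  have "2 * width (Suc n) \<le> real (q n) * width (Suc n)"
    using q_ge_2[of n] less_imp_le[OF width_pos[of "Suc n"]] by (intro mult_right_mono) auto
  then show ?case using Suc by (simp add: width_Suc)
qed simp

lemma width_le_1: "width n \<le> 1"
  using width_le[of n] by (rule order_trans) (simp add: power_le_one)

lemma width_tendsto_0: "width \<longlonglongrightarrow> 0"
proof (rule tendsto_sandwich[OF _ _ tendsto_const LIMSEQ_realpow_zero])
  show "\<forall>\<^sub>F n in sequentially. width n \<le> (1 / 2) ^ n" using width_le by simp
qed (auto simp: less_imp_le)

definition copy_of :: "nat \<Rightarrow> nat \<Rightarrow> nat" where
  "copy_of n p = (THE b. b < q n \<and> (\<exists>j<h n. p = pos n b + j))"

lemma copy_of_eq: "b < q n \<Longrightarrow> j < h n \<Longrightarrow> copy_of n (pos n b + j) = b"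
  unfolding copy_of_def by (rule the_equality) (use copy_unique in blast)+

text \<open>The levels of the towers are realised as half-open intervals of the real line. A level
  which is not cut out of an earlier one starts at an integer that encodes its stage and its
  position, so that such levels never overlap.\<close>

primrec left :: "nat \<Rightarrow> nat \<Rightarrow> real" where
  "left 0 p = real (prod_encode (0, p))"
| "left (Suc n) p = (if \<exists>b<q n. \<exists>j<h n. p = pos n b + j
     then left n (p - pos n (copy_of n p)) + real (copy_of n p) * width (Suc n)
     else real (prod_encode (Suc n, p)))"

declare left.simps(2) [simp del]

lemma left_copy:
  "b < q n \<Longrightarrow> j < h n \<Longrightarrow> left (Suc n) (pos n b + j) = left n j + real b * width (Suc n)"
  by (auto simp: left.simps(2) copy_of_eq)

lemma left_spacer:
  "\<not> (\<exists>b<q n. \<exists>j<h n. p = pos n b + j) \<Longrightarrow> left (Suc n) p = real (prod_encode (Suc n, p))"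
  unfolding left.simps(2) by (rule if_not_P)

definition level :: "nat \<Rightarrow> nat \<Rightarrow> real set" where
  "level n p = {left n p ..< left n p + width n}"

lemma level_copy_subset: "b < q n \<Longrightarrow> j < h n \<Longrightarrow> level (Suc n) (pos n b + j) \<subseteq> level n j"
proof -
  assume b: "b < q n" and j: "j < h n"
  have "(real b + 1) * width (Suc n) \<le> real (q n) * width (Suc n)"
    using b less_imp_le[OF width_pos[of "Suc n"]] by (intro mult_right_mono) auto
  then have "real b * width (Suc n) + width (Suc n) \<le> width n"
    unfolding width_Suc by (simp add: algebra_simps)
  moreover have "0 \<le> real b * width (Suc n)"
    using less_imp_le[OF width_pos[of "Suc n"]] by simp
  ultimately show ?thesis
    unfolding level_def left_copy[OF b j] by auto
qed

lemma level_split: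
  assumes j: "j < h n"
  shows "level n j = (\<Union>b<q n. level (Suc n) (pos n b + j))"
proof (intro equalityI subsetI)
  fix x assume x: "x \<in> level n j"
  define b where "b = nat \<lfloor>(x - left n j) / width (Suc n)\<rfloor>"
  have "0 \<le> (x - left n j) / width (Suc n)"
    using x less_imp_le[OF width_pos[of "Suc n"]] by (auto simp: level_def)
  then have b: "real b \<le> (x - left n j) / width (Suc n)" "(x - left n j) / width (Suc n) < real b + 1"
    unfolding b_def by linarith+
  have "(x - left n j) / width (Suc n) < real (q n)"
    using x by (simp add: level_def pos_divide_less_eq width_Suc)
  then have "b < q n" using b by linarith
  moreover have "real b * width (Suc n) \<le> x - left n j"
    "x - left n j < real b * width (Suc n) + width (Suc n)"
    using b by (simp_all add: pos_le_divide_eq pos_divide_less_eq distrib_right)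
  then have "x \<in> level (Suc n) (pos n b + j)"
    unfolding level_def left_copy[OF \<open>b < q n\<close> j] by auto
  ultimately show "x \<in> (\<Union>b<q n. level (Suc n) (pos n b + j))" by blast
qed (use level_copy_subset j in blast)

text \<open>The unit interval is the one reserved for the ancestor from which the level was cut, and
  its code records the stage \<open>m \<le> n\<close> of that ancestor. Spacers inserted at stage
  \<open>n + 1\<close> carry a code of their own stage and so avoid everything older.\<close>

lemma level_subset_unit:
  "\<exists>m\<le>n. \<exists>r. level n p \<subseteq> {real (prod_encode (m, r)) ..< real (prod_encode (m, r)) + 1}"
proof (induction n arbitrary: p)
  case 0
  show ?case by (intro exI[of _ 0] conjI exI[of _ p]) (auto simp: level_def)
next
  case (Suc n)
  show ?case
  proof (cases "\<exists>b<q n. \<exists>j<h n. p = pos n b + j")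
    case True
    then obtain b j where "b < q n" "j < h n" "p = pos n b + j" by blast
    then have sub: "level (Suc n) p \<subseteq> level n j" using level_copy_subset by simp
    obtain m r where "m \<le> n" "level n j \<subseteq> {real (prod_encode (m, r)) ..< real (prod_encode (m, r)) + 1}"
      using Suc.IH[of j] by blast
    with sub show ?thesis by (intro exI[of _ m] conjI exI[of _ r]) auto
  next
    case False
    then have "level (Suc n) p \<subseteq> {real (prod_encode (Suc n, p)) ..< real (prod_encode (Suc n, p)) + 1}"
      using width_le_1[of "Suc n"] left_spacer[OF False] by (auto simp: level_def)
    then show ?thesis by (intro exI[of _ "Suc n"] conjI exI[of _ p]) auto
  qed
qed

lemma unit_unique:
  fixes a b :: nat
  assumes "x \<in> {real a ..< real a + 1}" "x \<in> {real b ..< real b + 1}"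
  shows "a = b"
  using assms by auto

lemma level_disjoint:
  assumes "x \<in> level n p" "x \<in> level n p'"
  shows "p = p'"
  using assms
proof (induction n arbitrary: p p')
  case 0
  then show ?case
    using unit_unique[of x "prod_encode (0, p)" "prod_encode (0, p')"] by (auto simp: level_def)
next
  case (Suc n)
  have wlog: "p = p'" if p: "x \<in> level (Suc n) p" "x \<in> level (Suc n) p'"
    and nex: "\<not> (\<exists>b<q n. \<exists>j<h n. p' = pos n b + j)" for p p'
  proof -
    have x': "x \<in> {real (prod_encode (Suc n, p')) ..< real (prod_encode (Suc n, p')) + 1}"
      using p(2) left_spacer[OF nex] width_le_1[of "Suc n"] by (auto simp: level_def)
    show ?thesis
    proof (cases "\<exists>b<q n. \<exists>j<h n. p = pos n b + j")
      case True
      then obtain b j where "b < q n" "j < h n" "p = pos n b + j" by blast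
      then have "x \<in> level n j" using p(1) level_copy_subset by blast
      then obtain m r where m: "m \<le> n" "x \<in> {real (prod_encode (m, r)) ..< real (prod_encode (m, r)) + 1}"
        using level_subset_unit[of n j] by blast
      show ?thesis using unit_unique[OF x' m(2)] m(1) by simp
    next
      case False
      then have x: "x \<in> {real (prod_encode (Suc n, p)) ..< real (prod_encode (Suc n, p)) + 1}"
        using p(1) left_spacer[OF False] width_le_1[of "Suc n"] by (auto simp: level_def)
      show ?thesis using unit_unique[OF x' x] by simp
    qed
  qed
  show ?case
  proof (cases "(\<exists>b<q n. \<exists>j<h n. p = pos n b + j) \<and> (\<exists>b<q n. \<exists>j<h n. p' = pos n b + j)")
    case True
    then obtain b j b' j' where bj: "b < q n" "j < h n" "p = pos n b + j"
      "b' < q n" "j' < h n" "p' = pos n b' + j'" by blast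
    have "x \<in> level n j" "x \<in> level n j'"
      using Suc.prems bj level_copy_subset by blast+
    then have "j = j'" using Suc.IH by blast
    \<comment> \<open>The offset inside the common parent level in units of the new width; its
      integer part is the index of the copy.\<close>
    define y where "y = (x - left n j) / width (Suc n)"
    have y: "y \<in> {real c ..< real c + 1}" if "c < q n" "x \<in> level (Suc n) (pos n c + j)" for c
      using that(2) unfolding y_def level_def left_copy[OF that(1) \<open>j < h n\<close>]
      by (simp add: pos_le_divide_eq pos_divide_less_eq distrib_right)
    have "y \<in> {real b ..< real b + 1}" "y \<in> {real b' ..< real b' + 1}"
      using Suc.prems bj \<open>j = j'\<close> by (auto intro!: y simp del: atLeastLessThan_iff)
    then show ?thesis using unit_unique bj \<open>j = j'\<close> by blast
  next
    case False
    then show ?thesis using wlog[of p p'] wlog[of p' p] Suc.prems by blast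
  qed
qed

definition stage :: "nat \<Rightarrow> real set" where
  "stage n = (\<Union>p<h n. level n p)"

lemma stage_subset_Suc: "stage n \<subseteq> stage (Suc n)"
proof
  fix x assume "x \<in> stage n"
  then obtain p where "p < h n" "x \<in> level n p" by (auto simp: stage_def)
  moreover from this obtain b where "b < q n" "x \<in> level (Suc n) (pos n b + p)"
    using level_split by blast
  ultimately show "x \<in> stage (Suc n)"
    using pos_add_less[of b n p] by (auto simp: stage_def)
qed

lemma incseq_stage: "incseq stage"
  using stage_subset_Suc by (rule incseq_SucI)

definition support :: "real set" where
  "support = (\<Union>n. stage n)"

lemma level_subset_support: "p < h n \<Longrightarrow> level n p \<subseteq> support"
  by (auto simp: support_def stage_def)

text \<open>Each base is the first slice of the previous one, so all bases share the left endpoint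
  \<open>0\<close>. This point therefore has no predecessor in any tower.\<close>

lemma left_0 [simp]: "left n 0 = 0"
proof (induction n)
  case (Suc n)
  then show ?case using left_copy[of 0 n 0] q_pos[of n] h_pos[of n] by (simp add: pos_0 del: left.simps)
qed (simp add: prod_encode_def)

lemma left_nonneg: "0 \<le> left n p"
  by (induction n arbitrary: p) (auto intro!: add_nonneg_nonneg simp: left.simps(2) less_imp_le)

lemma support_nonneg: "x \<in> support \<Longrightarrow> 0 \<le> x"
  using left_nonneg by (auto simp: support_def stage_def level_def intro: order_trans)

section \<open>The tower map as a relation consistent across stages\<close>

lemma level_later:
  assumes "x \<in> level n p" "p < h n" "n \<le> m"
  obtains p' where "x \<in> level m p'" "p' < h m"
proof -
  have "stage n \<subseteq> stage m" using incseq_stage assms(3) by (auto simp: incseq_def)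
  then have "x \<in> stage m" using assms(1,2) by (auto simp: stage_def)
  then show ?thesis using that by (auto simp: stage_def)
qed

text \<open>A relation rather than a function, since the displacement may be read off at any stage
  where the point is not on the top level; that all these stages agree has to be proved.\<close>

definition step :: "real \<Rightarrow> real \<Rightarrow> bool" where
  "step x d \<longleftrightarrow> (\<exists>n p. Suc p < h n \<and> x \<in> level n p \<and> d = left n (Suc p) - left n p)"

text \<open>Adjacent levels are cut alike: copy \<open>b\<close> adds the same multiple of the new
  width to both left endpoints, so the displacement survives refinement.\<close>

lemma step_later:
  assumes "Suc p < h n" "x \<in> level n p" "n \<le> m"
  shows "\<exists>p'. Suc p' < h m \<and> x \<in> level m p' \<and> left m (Suc p') - left m p' = left n (Suc p) - left n p"
  using assms(3)
proof (induction m rule: dec_induct)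
  case base
  show ?case using assms by blast
next
  case (step m)
  then obtain p' where p': "Suc p' < h m" "x \<in> level m p'"
    "left m (Suc p') - left m p' = left n (Suc p) - left n p" by blast
  then obtain b where b: "b < q m" "x \<in> level (Suc m) (pos m b + p')"
    using level_split[of p' m] by auto
  moreover have "left (Suc m) (Suc (pos m b + p')) - left (Suc m) (pos m b + p') = left m (Suc p') - left m p'"
    using left_copy[OF b(1) p'(1)] left_copy[OF b(1) Suc_lessD[OF p'(1)]] by simp
  ultimately show ?case
    using pos_add_less[OF b(1) p'(1)] p' by (intro exI[of _ "pos m b + p'"]) simp
qed

lemma steps_common:
  assumes "step x d" "step x' d'"
  obtains n p p' where "Suc p < h n" "x \<in> level n p" "d = left n (Suc p) - left n p"
    "Suc p' < h n" "x' \<in> level n p'" "d' = left n (Suc p') - left n p'"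
proof -
  obtain n p where 1: "Suc p < h n" "x \<in> level n p" "d = left n (Suc p) - left n p"
    using assms(1) by (auto simp: step_def)
  obtain n' p' where 2: "Suc p' < h n'" "x' \<in> level n' p'" "d' = left n' (Suc p') - left n' p'"
    using assms(2) by (auto simp: step_def)
  show ?thesis
    using step_later[OF 1(1,2), of "max n n'"] step_later[OF 2(1,2), of "max n n'"] 1(3) 2(3) that
    by (metis max.cobounded1 max.cobounded2)
qed

lemma level_translate:
  "x \<in> level n p \<Longrightarrow> x + (left n p' - left n p) \<in> level n p'"
  by (auto simp: level_def)

lemma step_unique:
  assumes "step x d" "step x d'"
  shows "d = d'"
  using steps_common[OF assms] level_disjoint by metis

lemma step_inj:
  assumes "step x d" "step x' d'" "x + d = x' + d'"
  shows "x = x'"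
proof -
  obtain n p p' where *: "Suc p < h n" "x \<in> level n p" "d = left n (Suc p) - left n p"
    "Suc p' < h n" "x' \<in> level n p'" "d' = left n (Suc p') - left n p'"
    using steps_common[OF assms(1,2)] by blast
  have "x + d \<in> level n (Suc p)" "x' + d' \<in> level n (Suc p')"
    using * level_translate by auto
  then have "p = p'" using level_disjoint assms(3) by force
  then show ?thesis using * assms(3) by simp
qed

lemma step_target:
  assumes "step x d"
  shows "x + d \<in> support" "x + d \<noteq> 0"
proof -
  obtain n p where *: "Suc p < h n" "x \<in> level n p" "d = left n (Suc p) - left n p"
    using assms by (auto simp: step_def)
  then have in_level: "x + d \<in> level n (Suc p)" using level_translate by simp
  then show "x + d \<in> support" using * level_subset_support by blast
  have "0 \<in> level n 0" by (simp add: level_def)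
  then show "x + d \<noteq> 0" using in_level level_disjoint by fastforce
qed

text \<open>All top levels of the towers share their right endpoint, which does not belong to them.\<close>

lemma ex_step:
  assumes "x \<in> support"
  shows "\<exists>d. step x d"
proof (rule ccontr)
  assume no: "\<nexists>d. step x d"
  obtain n p where np: "p < h n" "x \<in> level n p"
    using assms by (auto simp: support_def stage_def)
  have top: "x \<in> level m (h m - 1)" if nm: "n \<le> m" for m
  proof -
    obtain p' where p': "x \<in> level m p'" "p' < h m" using level_later np nm by metis
    then have "Suc p' = h m" using no by (auto simp: step_def) (metis Suc_lessI)
    then show ?thesis using p' by (metis diff_Suc_1)
  qed
  have right: "left m (h m - 1) + width m = left n (h n - 1) + width n" if "n \<le> m" for m
    using that
  proof (induction m rule: dec_induct)
    case (step m)
    have "h (Suc m) - 1 = pos m (q m - 1) + (h m - 1)"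
      using pos_last[of m] h_pos[of m] by simp
    then have "left (Suc m) (h (Suc m) - 1) = left m (h m - 1) + real (q m - 1) * width (Suc m)"
      using left_copy[of "q m - 1" m "h m - 1"] q_pos[of m] h_pos[of m] by simp
    moreover have "real (q m - 1) * width (Suc m) + width (Suc m) = width m"
      using q_pos[of m] by (simp add: of_nat_diff Suc_leI algebra_simps width_Suc)
    ultimately show ?case using step.IH by simp
  qed simp
  have "left n (h n - 1) + width n - x \<le> width m" if "n \<le> m" for m
  proof -
    have "left m (h m - 1) \<le> x" using top[OF that] by (simp add: level_def)
    then show ?thesis using right[OF that] by linarith
  qed
  then have "left n (h n - 1) + width n - x \<le> 0"
    by (intro tendsto_lowerbound[OF width_tendsto_0])
       (auto simp: eventually_sequentially)
  moreover have "x < left n (h n - 1) + width n" using top[of n] by (auto simp: level_def)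
  ultimately show False by simp
qed

text \<open>A point without predecessor lies in the base of every late tower, and the bases
  \<open>[0, width m)\<close> shrink to the point \<open>0\<close>.\<close>

lemma ex_step_to:
  assumes "y \<in> support" "y \<noteq> 0"
  shows "\<exists>x d. x \<in> support \<and> step x d \<and> y = x + d"
proof (rule ccontr)
  assume no: "\<not> ?thesis"
  obtain n p where np: "p < h n" "y \<in> level n p"
    using assms by (auto simp: support_def stage_def)
  have "y \<le> width m" if nm: "n \<le> m" for m
  proof -
    obtain p' where p': "y \<in> level m p'" "p' < h m" using level_later np nm by metis
    have "p' = 0"
    proof (cases p')
      case (Suc r)
      define x where "x = y + (left m r - left m p')"
      have "x \<in> level m r" using p' level_translate by (simp add: x_def)
      then have "x \<in> support" "step x (left m p' - left m r)"
        using p' Suc level_subset_support[of r m] by (auto simp: step_def)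
      moreover have "y = x + (left m p' - left m r)" by (simp add: x_def)
      ultimately show ?thesis using no by blast
    qed
    then show ?thesis using p' by (simp add: level_def)
  qed
  then have "y \<le> 0"
    by (intro tendsto_lowerbound[OF width_tendsto_0]) (auto simp: eventually_sequentially)
  then show False using support_nonneg assms by fastforce
qed

text \<open>On the support the tower map misses only the point \<open>0\<close>. Sending the null set of negative
  integers towards \<open>0\<close> makes it a bijection of the real line.\<close>

definition neg_ints :: "real set" where
  "neg_ints = range (\<lambda>k. - 1 - real k)"

definition T :: "real \<Rightarrow> real" where
  "T x = (if x \<in> support then x + (THE d. step x d) else if x \<in> neg_ints then x + 1 else x)"

lemma T_step: "x \<in> support \<Longrightarrow> step x d \<Longrightarrow> T x = x + d"
proof -
  assume x: "x \<in> support" and d: "step x d"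
  have "(THE d. step x d) = d"
    by (rule the_equality[where P = "step x", OF d]) (rule step_unique[OF _ d])
  then show "T x = x + d" using x by (simp add: T_def)
qed

lemma T_level:
  assumes "Suc p < h n" "x \<in> level n p"
  shows "T x = x + (left n (Suc p) - left n p)"
proof (rule T_step)
  show "x \<in> support" using assms level_subset_support[of p n] by auto
  show "step x (left n (Suc p) - left n p)" using assms unfolding step_def by blast
qed

lemma neg_ints_neg: "x \<in> neg_ints \<Longrightarrow> x < 0"
  by (auto simp: neg_ints_def)

lemma neg_ints_not_support: "x \<in> neg_ints \<Longrightarrow> x \<notin> support"
  using neg_ints_neg support_nonneg by fastforce

lemma zero_support: "0 \<in> support"
  using level_subset_support[OF h_pos[of 0]] by (auto simp: level_def)

lemma neg_ints_step: "x \<in> neg_ints \<Longrightarrow> x + 1 \<in> neg_ints \<or> x + 1 = 0"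
proof -
  assume "x \<in> neg_ints"
  then obtain k where "x = - 1 - real k" by (auto simp: neg_ints_def)
  then show ?thesis by (cases k) (auto simp: neg_ints_def)
qed

lemma T_cases:
  obtains (support) d where "x \<in> support" "step x d" "T x = x + d" "T x \<in> support" "T x \<noteq> 0"
  | (neg) "x \<in> neg_ints" "T x = x + 1" "T x \<in> neg_ints \<or> T x = 0"
  | (rest) "x \<notin> support" "x \<notin> neg_ints" "T x = x"
proof (cases "x \<in> support")
  case True
  then obtain d where d: "step x d" using ex_step by blast
  then have "T x = x + d" using True by (rule T_step[rotated])
  then show ?thesis using support[of d] True d step_target[OF d] by simp
next
  case False
  show ?thesis
  proof (cases "x \<in> neg_ints")
    case True
    then have "T x = x + 1" using \<open>x \<notin> support\<close> by (simp add: T_def)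
    then show ?thesis using neg neg_ints_step[OF True] True by simp
  next
    case False
    then have "T x = x" using \<open>x \<notin> support\<close> by (simp add: T_def)
    then show ?thesis using rest False \<open>x \<notin> support\<close> by simp
  qed
qed

lemma inj_T: "inj T"
proof (rule injI)
  fix x y assume eq: "T x = T y"
  show "x = y"
  proof (cases rule: T_cases[where x = x])
    case x: (support d)
    show ?thesis
    proof (cases rule: T_cases[where x = y])
      case y: (support d')
      show ?thesis using step_inj[OF x(2) y(2)] x(3) y(3) eq by simp
    next
      case neg
      then show ?thesis using x(4,5) neg_ints_not_support unfolding eq by blast
    next
      case rest
      then show ?thesis using x(4) unfolding eq by simp
    qed
  next
    case x: neg
    show ?thesis
    proof (cases rule: T_cases[where x = y])
      case support
      then show ?thesis using x(3) neg_ints_not_support unfolding eq by blast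
    next
      case y: neg
      have "x + 1 = y + 1" unfolding x(2)[symmetric] y(2)[symmetric] by (rule eq)
      then show ?thesis by simp
    next
      case rest
      then show ?thesis using x(3) zero_support unfolding eq by auto
    qed
  next
    case x: rest
    show ?thesis
    proof (cases rule: T_cases[where x = y])
      case support
      then show ?thesis using x(1,3) unfolding eq by simp
    next
      case neg
      then show ?thesis using x(1-3) zero_support unfolding eq by auto
    next
      case y: rest
      show ?thesis using eq unfolding x(3) y(3) .
    qed
  qed
qed

lemma surj_T: "surj T"
proof -
  have "\<exists>x. T x = y" for y
  proof (cases "y \<in> support \<and> y \<noteq> 0")
    case True
    then show ?thesis using ex_step_to T_step by metis
  next
    case False
    show ?thesis
    proof (cases "y \<in> neg_ints \<or> y = 0")
      case True
      then have "y - 1 \<in> neg_ints"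
      proof
        assume "y \<in> neg_ints"
        then obtain k where "y = - 1 - real k" by (auto simp: neg_ints_def)
        then have "y - 1 = - 1 - real (Suc k)" by simp
        then show ?thesis unfolding neg_ints_def by blast
      next
        assume "y = 0"
        then have "y - 1 = - 1 - real 0" by simp
        then show ?thesis unfolding neg_ints_def by blast
      qed
      then have "T (y - 1) = y" using neg_ints_not_support by (simp add: T_def)
      then show ?thesis by blast
    next
      case False
      then have "T y = y" using \<open>\<not> (y \<in> support \<and> y \<noteq> 0)\<close> by (auto simp: T_def)
      then show ?thesis by blast
    qed
  qed
  then show ?thesis unfolding surj_def by metis
qed

lemma bij_T: "bij T"
  using inj_T surj_T by (rule bijI)

section \<open>Measurability and invariance of Lebesgue measure\<close>

lemma level_measurable [measurable]: "level n p \<in> sets borel"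
  by (simp add: level_def)

lemma stage_measurable [measurable]: "stage n \<in> sets borel"
  by (auto simp: stage_def)

lemma support_measurable [measurable]: "support \<in> sets borel"
  by (auto simp: support_def)

lemma neg_ints_countable: "countable neg_ints"
  by (simp add: neg_ints_def)

lemma neg_ints_measurable [measurable]: "neg_ints \<in> sets borel"
  by (rule sets.countable) (auto simp: neg_ints_countable)

lemma T_lborel:
  shows T_measurable: "T \<in> borel_measurable borel"
    and inv_T_measurable: "inv T \<in> borel_measurable borel"
    and distr_T: "distr lborel borel T = lborel"
proof -
  \<comment> \<open>\<open>1\<close> is the displacement on \<open>neg_ints\<close> and
    \<open>0\<close> that of the remaining points off the support; all others come from the
    countably many pairs of adjacent levels.\<close>
  define D where "D = {0, 1} \<union> range (\<lambda>(n, p). left n (Suc p) - left n p)"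
  have D: "countable D" by (simp add: D_def)
  have TD: "T x - x \<in> D" for x
    by (cases rule: T_cases[where x = x]) (auto simp: D_def step_def)
  have P: "{x. T x - x = d} \<in> sets borel" for d
  proof -
    have "{x. T x - x = d} =
      (\<Union>(n, p)\<in>{(n, p). Suc p < h n \<and> left n (Suc p) - left n p = d}. level n p) \<union>
      (if d = 1 then neg_ints else {}) \<union> (if d = 0 then - (support \<union> neg_ints) else {})"
      (is "_ = ?R")
    proof (intro equalityI subsetI)
      fix x assume x: "x \<in> {x. T x - x = d}"
      show "x \<in> ?R"
      proof (cases rule: T_cases[where x = x])
        case (support d')
        then obtain n p where "Suc p < h n" "x \<in> level n p" "d' = left n (Suc p) - left n p"
          unfolding step_def by blast
        moreover have "d' = d" using x support(3) by simp
        ultimately show ?thesis by (intro UnI1 UN_I[of "(n, p)"]) auto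
      qed (use x in auto)
    next
      fix x assume x: "x \<in> ?R"
      then consider n p where "Suc p < h n" "x \<in> level n p" "left n (Suc p) - left n p = d"
        | "x \<in> neg_ints" "d = 1" | "x \<notin> support" "x \<notin> neg_ints" "d = 0"
        by (auto split: if_splits)
      then show "x \<in> {x. T x - x = d}"
        by cases (use T_level neg_ints_not_support in \<open>auto simp: T_def\<close>)
    qed
    moreover have "?R \<in> sets borel"
      by (intro sets.Un sets.countable_UN') auto
    ultimately show ?thesis by simp
  qed
  show "T \<in> borel_measurable borel" "inv T \<in> borel_measurable borel" "distr lborel borel T = lborel"
    using piecewise_translation_lborel[OF bij_T D TD P] by auto
qed

lemma T_pow_level:
  assumes "p + k < h n" "x \<in> level n p"
  shows "(T ^^ k) x = x + (left n (p + k) - left n p)"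
  using assms(1)
proof (induction k)
  case (Suc k)
  then have IH: "(T ^^ k) x = x + (left n (p + k) - left n p)" by simp
  then have "(T ^^ k) x \<in> level n (p + k)" using level_translate[OF assms(2)] by simp
  then have "T ((T ^^ k) x) = (T ^^ k) x + (left n (Suc (p + k)) - left n (p + k))"
    using Suc.prems by (intro T_level) auto
  then show ?case using IH by simp
qed simp

lemma T_pow_in_level: "p + k < h n \<Longrightarrow> x \<in> level n p \<Longrightarrow> (T ^^ k) x \<in> level n (p + k)"
  using T_pow_level[of p k n x] level_translate[of x n p "p + k"] by simp

lemma T_pow_image_level:
  assumes "p + k < h n"
  shows "(T ^^ k) ` level n p = level n (p + k)"
proof (intro equalityI subsetI)
  fix y assume "y \<in> level n (p + k)"
  then have x: "y + (left n p - left n (p + k)) \<in> level n p" by (rule level_translate)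
  show "y \<in> (T ^^ k) ` level n p"
    using T_pow_level[OF assms x] x by (intro image_eqI[OF _ x]) simp
qed (use T_pow_in_level[OF assms] in auto)

lemma tower_eq_stage: "tower T (level n 0) (h n) = stage n"
  unfolding tower_def stage_def by (intro SUP_cong refl) (simp add: T_pow_image_level)

lemma tower_partition_eq:
  "tower_partition N T (level n 0) (h n) = insert (space N - stage n) (level n ` {..<h n})"
  unfolding tower_partition_def tower_eq_stage
  by (intro arg_cong[where f = "insert _"] image_cong refl) (simp add: T_pow_image_level)

section \<open>Mass of the towers and the invariant probability measure\<close>

lemma emeasure_levels:
  assumes "finite P"
  shows "emeasure lborel (\<Union>p\<in>P. level n p) = ennreal (real (card P) * width n)"
proof -
  have "emeasure lborel (\<Union>p\<in>P. level n p) = (\<Sum>p\<in>P. emeasure lborel (level n p))"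
    using assms level_disjoint
    by (intro sum_emeasure[symmetric]) (auto simp: disjoint_family_on_def)
  also have "\<dots> = (\<Sum>p\<in>P. ennreal (width n))"
    by (intro sum.cong refl) (simp add: level_def less_imp_le)
  also have "\<dots> = ennreal (real (card P) * width n)"
    by (simp add: ennreal_mult less_imp_le flip: ennreal_of_nat_eq_real_of_nat)
  finally show ?thesis .
qed

lemma emeasure_stage: "emeasure lborel (stage n) = ennreal (real (h n) * width n)"
  using emeasure_levels[of "{..<h n}"] by (simp add: stage_def)

definition total :: real where
  "total = measure lborel support"

lemma emeasure_support: "emeasure lborel support = ennreal total"
  and stage_tendsto_total: "(\<lambda>n. real (h n) * width n) \<longlonglongrightarrow> total"
  and total_ge_1: "1 \<le> total"
proof -
  obtain C where C: "\<And>n. real (h n) \<le> C * (\<Prod>m<n. real (q m))" using h_bounded by blast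
  have "real (h n) * width n \<le> C" for n
    using C[of n] q_pos by (simp add: width_def pos_divide_le_eq prod_pos)
  then have "emeasure lborel (stage n) \<le> ennreal C" for n
    unfolding emeasure_stage by (rule ennreal_leI)
  moreover have lim: "(\<lambda>n. emeasure lborel (stage n)) \<longlonglongrightarrow> emeasure lborel support"
    unfolding support_def by (intro Lim_emeasure_incseq incseq_stage) auto
  ultimately have "emeasure lborel support \<le> ennreal C"
    by (intro tendsto_upperbound[OF lim]) auto
  then show em: "emeasure lborel support = ennreal total"
    unfolding total_def by (intro emeasure_eq_ennreal_measure) (auto simp: top_unique)
  have "(\<lambda>n. ennreal (real (h n) * width n)) \<longlonglongrightarrow> ennreal total"
    using lim unfolding em emeasure_stage .
  then show "(\<lambda>n. real (h n) * width n) \<longlonglongrightarrow> total"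
    by (rule tendsto_ennrealD) (auto simp: total_def less_imp_le)
  have "emeasure lborel (stage 0) \<le> emeasure lborel support"
    by (intro emeasure_mono) (auto simp: support_def)
  then have "real (h 0) * width 0 \<le> total"
    unfolding em emeasure_stage by (subst (asm) ennreal_le_iff) (simp_all add: total_def)
  then show "1 \<le> total" using h_0 by (simp add: Suc_leI order_trans[of 1 "real (h 0)"])
qed

text \<open>The space stays the whole real line, with a null set off the support: \<open>M\<close>
  is then visibly standard and \<open>T\<close> is a genuine bijection of its space.\<close>

definition M :: "real measure" where
  "M = uniform_measure lborel support"

lemma space_M [simp]: "space M = UNIV" and sets_M [simp, measurable_cong]: "sets M = sets borel"
  by (simp_all add: M_def)

lemma prob_space_M: "prob_space M"
  unfolding M_def using total_ge_1 by (intro prob_space_uniform_measure) (auto simp: emeasure_support)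

sublocale prob_space M
  by (rule prob_space_M)

lemma emeasure_M: "A \<in> sets borel \<Longrightarrow> emeasure M A = emeasure lborel (support \<inter> A) / ennreal total"
  by (simp add: M_def emeasure_support)

lemma prob_levels:
  assumes "P \<subseteq> {..<h n}"
  shows "prob (\<Union>p\<in>P. level n p) = real (card P) * width n / total"
proof -
  have [simp]: "finite P" using assms finite_subset by blast
  have "support \<inter> (\<Union>p\<in>P. level n p) = (\<Union>p\<in>P. level n p)"
    using assms level_subset_support[of _ n] by blast
  then have "emeasure M (\<Union>p\<in>P. level n p) = ennreal (real (card P) * width n) / ennreal total"
    by (subst emeasure_M) (auto simp: emeasure_levels intro!: sets.countable_UN')
  also have "\<dots> = ennreal (real (card P) * width n / total)"
    using total_ge_1 by (intro divide_ennreal) (auto simp: less_imp_le)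
  finally show ?thesis
    using total_ge_1 by (simp add: measure_def less_imp_le)
qed

lemma null_off_support: "UNIV - support \<in> null_sets M"
  by (intro null_setsI) (auto simp: emeasure_M)

lemma standard_M: "standard_probability_space M"
  unfolding standard_probability_space_def
proof (intro conjI exI[of _ euclidean])
  show "second_countable (euclidean :: real topology)"
  proof -
    obtain B :: "real set set" where B: "countable B" "topological_basis B"
      using ex_countable_basis by blast
    have "\<exists>V\<in>B. x \<in> V \<and> V \<subseteq> U" if "open U" "x \<in> U" for U x
      using topological_basisE[OF B(2) that] by metis
    moreover have "open V" if "V \<in> B" for V
      using topological_basis_open[OF B(2) that] .
    ultimately show ?thesis
      unfolding second_countable_def open_openin[symmetric] using B(1) by blast
  qed
  show "sets M = sigma_sets (topspace euclidean) {U. openin euclidean U}"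
    by (simp add: borel_def)
qed (auto simp: prob_space_M completely_metrizable_space_euclidean)

lemma measure_preserving_M: "measure_preserving_system M T"
  unfolding measure_preserving_system_def
proof (intro conjI standard_M)
  show "bij_betw T (space M) (space M)" using bij_T by simp
  show T: "T \<in> measurable M M" using T_measurable by (simp cong: measurable_cong_sets)
  have "the_inv_into (space M) T = inv T"
    using bij_T by (auto simp: fun_eq_iff bij_def surj_f_inv_f intro!: the_inv_into_f_eq)
  then show "the_inv_into (space M) T \<in> measurable M M"
    using inv_T_measurable by (simp cong: measurable_cong_sets)
  show "distr M M T = M"
  proof (rule measure_eqI)
    fix A assume "A \<in> sets (distr M M T)"
    then have A[measurable]: "A \<in> sets borel" by simp
    note T_measurable[measurable]
    have TA: "T -` A \<in> sets borel" "T -` (support \<inter> A) \<in> sets borel"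
      using measurable_sets[OF T_measurable, of A] measurable_sets[OF T_measurable, of "support \<inter> A"]
      by auto
    \<comment> \<open>The support is invariant except that \<open>-1\<close> is sent into it;
      discarding the null set \<open>neg_ints\<close> removes this exception.\<close>
    have "AE x in lborel. x \<notin> neg_ints"
      using neg_ints_countable by (intro AE_not_in countable_imp_null_set_lborel)
    then have ae: "AE x in lborel. x \<in> support \<inter> T -` A \<longleftrightarrow> x \<in> T -` (support \<inter> A)"
    proof eventually_elim
      fix x assume "x \<notin> neg_ints"
      then have "x \<in> support \<longleftrightarrow> T x \<in> support"
        by (cases rule: T_cases[where x = x]) auto
      then show "x \<in> support \<inter> T -` A \<longleftrightarrow> x \<in> T -` (support \<inter> A)" by auto
    qed
    have "emeasure (distr M M T) A = emeasure lborel (support \<inter> T -` A) / ennreal total"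
      using T TA by (simp add: emeasure_distr emeasure_M)
    also have "emeasure lborel (support \<inter> T -` A) = emeasure lborel (T -` (support \<inter> A))"
      using TA by (intro emeasure_eq_AE ae) auto
    also have "\<dots> = emeasure (distr lborel borel T) (support \<inter> A)"
      by (subst emeasure_distr) auto
    finally show "emeasure (distr M M T) A = emeasure M A"
      by (simp add: distr_T emeasure_M)
  qed simp
qed

section \<open>Verification of the rank one conditions\<close>

definition spacers :: "nat \<Rightarrow> nat \<Rightarrow> nat" where
  "spacers n i = pos n i - pos n (i - 1) - h n"

text \<open>Copies are numbered from \<open>0\<close> but spacer counts from \<open>1\<close>, so
  \<open>spacers n i\<close> belongs between copies \<open>i - 1\<close> and \<open>i\<close>. By
  \<open>pos_Suc\<close> the truncated subtraction is exact.\<close>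

lemma pos_spacers: "1 \<le> i \<Longrightarrow> i < q n \<Longrightarrow> pos n (i - 1) + (h n + spacers n i) = pos n i"
  using pos_Suc[of "i - 1" n] by (simp add: spacers_def)

lemma h_Suc: "h (Suc n) = q n * h n + (\<Sum>i=1..<q n. spacers n i)"
proof -
  have "pos n k = k * h n + (\<Sum>i=1..<Suc k. spacers n i)" if "k < q n" for k
    using that
  proof (induction k)
    case (Suc k)
    then show ?case using pos_spacers[of "Suc k" n] by simp
  qed (simp add: pos_0)
  from this[of "q n - 1"] show ?thesis
    using pos_last[of n] q_pos[of n] by (cases "q n") simp_all
qed

text \<open>\<open>h n * width n\<close> is the Lebesgue measure of stage \<open>n\<close>. Its
  increments are the mass of the new spacers and have a finite telescoping sum; as the measure is at
  least \<open>1\<close>, they dominate the ratios of spacers to height.\<close>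

lemma rank_one_parameters_h: "rank_one_parameters h q spacers"
  unfolding rank_one_parameters_def
proof (intro conjI allI impI)
  define x where "x n = real (h n) * width n" for n
  have x_ge: "1 \<le> x (Suc n)" and x_mono: "x n \<le> x (Suc n)" for n
  proof -
    have x_mono: "x n \<le> x (Suc n)" for n
    proof -
      have "x n = real (q n * h n) * width (Suc n)"
        unfolding x_def width_Suc[of n, symmetric] by simp
      also have "\<dots> \<le> x (Suc n)"
        unfolding x_def of_nat_mult[symmetric]
        by (intro mult_right_mono of_nat_mono) (simp_all add: h_Suc less_imp_le)
      finally show ?thesis .
    qed
    then show "x n \<le> x (Suc n)" .
    have "x 0 \<le> x (Suc n)" by (rule lift_Suc_mono_le[of x, OF x_mono]) simp
    moreover have "1 \<le> x 0" using h_0 by (simp add: x_def)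
    ultimately show "1 \<le> x (Suc n)" by simp
  qed
  have "summable (\<lambda>n. x (Suc n) - x n)"
    using stage_tendsto_total unfolding x_def[symmetric] by (rule telescope_summable)
  then have "summable (\<lambda>n. real (\<Sum>i=1..<q n. spacers n i) / real (h (Suc n)))"
  proof (rule summable_comparison_test'[where N = 0])
    fix n
    have num: "real (\<Sum>i=1..<q n. spacers n i) * width (Suc n) = x (Suc n) - x n"
      unfolding x_def width_Suc[of n, symmetric] h_Suc by (simp add: algebra_simps)
    have "real (\<Sum>i=1..<q n. spacers n i) / real (h (Suc n)) =
        real (\<Sum>i=1..<q n. spacers n i) * width (Suc n) / x (Suc n)"
      using less_imp_neq[OF width_pos[of "Suc n"]] unfolding x_def by simp
    also have "\<dots> \<le> x (Suc n) - x n"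
      unfolding num using x_ge[of n] x_mono[of n] by (simp add: divide_le_eq mult_le_cancel_left1)
    finally show "norm (real (\<Sum>i=1..<q n. spacers n i) / real (h (Suc n))) \<le> x (Suc n) - x n"
      unfolding real_norm_def abs_of_nonneg[OF divide_nonneg_nonneg[OF of_nat_0_le_iff of_nat_0_le_iff]] .
  qed
  then show "summable (\<lambda>n. real (\<Sum>i=1..<q (Suc n). spacers (Suc n) i) / real (h (Suc (Suc n))))"
    by (subst summable_Suc_iff)
qed (use h_pos q_pos h_less_Suc h_Suc in \<open>auto simp: Suc_le_eq\<close>)

text \<open>Widths tend to \<open>0\<close>, so around each point of an open set some late level
  fits inside it. Hence an open set meets the support in a countable union of levels, which can all
  be taken from stages \<open>n \<ge> 1\<close>.\<close>

lemma sigma_levels: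
  assumes "A \<in> sets borel"
  shows "A \<inter> support \<in> sigma_sets UNIV (\<Union>n\<in>{1..}. tower_partition M T (level n 0) (h n))"
    (is "_ \<in> sigma_sets _ ?\<G>")
proof -
  have lev: "level n p \<in> sigma_sets UNIV ?\<G>" if "1 \<le> n" "p < h n" for n p
    using that unfolding tower_partition_eq by (intro sigma_sets.Basic) auto
  have union: "(\<Union>i\<in>I. B i) \<in> sigma_sets UNIV ?\<G>"
    if "countable I" "\<And>i. i \<in> I \<Longrightarrow> B i \<in> sigma_sets UNIV ?\<G>" for I :: "'i set" and B
  proof -
    interpret sigma_algebra UNIV "sigma_sets UNIV ?\<G>" by (rule sigma_algebra_sigma_sets) auto
    show ?thesis using that by (intro countable_UN') auto
  qed
  have opens: "U \<inter> support \<in> sigma_sets UNIV ?\<G>" if "open U" for U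
  proof -
    have "U \<inter> support = (\<Union>(n, p)\<in>{(n, p). 1 \<le> n \<and> p < h n \<and> level n p \<subseteq> U}. level n p)" (is "_ = ?V")
    proof (intro equalityI subsetI)
      fix x assume x: "x \<in> U \<inter> support"
      then obtain e where e: "e > 0" "ball x e \<subseteq> U" using \<open>open U\<close> openE by blast
      obtain n0 p0 where np: "p0 < h n0" "x \<in> level n0 p0"
        using x by (auto simp: support_def stage_def)
      have "\<forall>\<^sub>F n in sequentially. width n < e"
        using width_tendsto_0 e(1) by (rule order_tendstoD)
      then have "\<forall>\<^sub>F n in sequentially. width n < e \<and> max 1 n0 \<le> n"
        using eventually_ge_at_top by (rule eventually_conj)
      then obtain n where n: "width n < e" "1 \<le> n" "n0 \<le> n"
        unfolding eventually_sequentially by (metis max.bounded_iff order_refl)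
      obtain p where p: "x \<in> level n p" "p < h n" using level_later[OF np(2,1) n(3)] .
      have "level n p \<subseteq> ball x e"
        using p(1) n(1) by (auto simp: level_def dist_real_def)
      then show "x \<in> ?V" using p n e by (intro UN_I[of "(n, p)"]) auto
    qed (use level_subset_support in auto)
    also have "\<dots> \<in> sigma_sets UNIV ?\<G>"
      using lev by (intro union) auto
    finally show ?thesis .
  qed
  have support: "support \<in> sigma_sets UNIV ?\<G>"
    using opens[of UNIV] by simp
  have "A \<in> sigma_sets UNIV {U. open U}"
    using assms by (simp add: borel_def)
  then show ?thesis
  proof induction
    case (Basic U)
    then show ?case using opens by simp
  next
    case Empty
    show ?case by (simp add: sigma_sets.Empty)
  next
    case (Compl B)
    interpret sigma_algebra UNIV "sigma_sets UNIV ?\<G>" by (rule sigma_algebra_sigma_sets) auto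
    have "(UNIV - B) \<inter> support = support - B \<inter> support" by blast
    then show ?case using Diff[OF support Compl.IH] by simp
  next
    case (Union B)
    have "\<Union> (range B) \<inter> support = (\<Union>i. B i \<inter> support)" by blast
    then show ?case using sigma_sets.Union[OF Union.IH] by simp
  qed
qed

lemma null_subsetI: "A \<subseteq> B \<Longrightarrow> null_subset N A B"
  by (simp add: null_subset_def Diff_eq_empty_iff[THEN iffD2])

lemma null_eq_refl: "null_eq N A A"
  by (simp add: null_eq_def null_subsetI)

lemma rank_one_towers_M:
  "rank_one_towers M T h q spacers (\<lambda>n. level n 0) (\<lambda>n i. level (Suc n) (pos n (i - 1)))"
  unfolding rank_one_towers_def
proof (intro conjI allI ballI impI)
  fix n :: nat
  show "0 < prob (level n 0)"
    using prob_levels[of "{0}" n] h_pos[of n] total_ge_1 by simp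
  fix i j assume "i < h n" "j < h n" "i \<noteq> j"
  then show "null_disjoint M ((T ^^ i) ` level n 0) ((T ^^ j) ` level n 0)"
    using level_disjoint[of _ n i j] by (auto simp: T_pow_image_level null_disjoint_def)
      (metis (no_types, lifting) Int_iff ex_in_conv null_sets.empty_sets)
next
  fix n :: nat
  have "(\<Union>i\<in>{1..q n}. level (Suc n) (pos n (i - 1))) = (\<Union>b<q n. level (Suc n) (pos n b + 0))"
    by (rule SUP_eq) (auto intro: bexI[of _ "Suc _"] bexI[of _ "_ - 1"])
  then show "null_eq M (level n 0) (\<Union>i\<in>{1..q n}. level (Suc n) (pos n (i - 1)))"
    using level_split[OF h_pos[of n]] null_eq_refl by metis
  fix i j assume ij: "i \<in> {1..q n}" "j \<in> {1..q n}" "i \<noteq> j"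
  have "level (Suc n) (pos n (i - 1)) \<inter> level (Suc n) (pos n (j - 1)) = {}"
  proof (rule ccontr)
    assume "\<not> ?thesis"
    then have "pos n (i - 1) + 0 = pos n (j - 1) + 0" using level_disjoint by fastforce
    then have "i - 1 = j - 1"
      using copy_unique[of n "i - 1" 0 "j - 1" 0] ij h_pos[of n] by auto
    then show False using ij by auto
  qed
  then show "null_disjoint M (level (Suc n) (pos n (i - 1))) (level (Suc n) (pos n (j - 1)))"
    by (simp add: null_disjoint_def)
next
  fix n i assume i: "i \<in> {1..<q n}"
  have "(T ^^ (h n + spacers n i)) ` level (Suc n) (pos n (i - 1)) = level (Suc n) (pos n i)"
    using i pos_spacers[of i n] pos_add_less[of i n 0] h_pos[of n]
    by (subst T_pow_image_level) auto
  then show "null_eq M ((T ^^ (h n + spacers n i)) ` level (Suc n) (pos n (i - 1)))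
      (level (Suc n) (pos n (Suc i - 1)))"
    by (simp add: null_eq_refl)
next
  fix n :: nat
  show "null_eq M (level (Suc n) 0) (level (Suc n) (pos n (1 - 1)))"
    by (simp add: pos_0 null_eq_refl)
  fix A assume "A \<in> tower_partition M T (level (Suc n) 0) (h (Suc n))"
  then consider "A = UNIV - stage (Suc n)" | p where "A = level (Suc n) p" "p < h (Suc n)"
    unfolding tower_partition_eq by auto
  then have "\<exists>B\<in>insert (UNIV - stage n) (level n ` {..<h n}). A \<subseteq> B"
  proof cases
    case 1
    then show ?thesis
      using stage_subset_Suc[of n] by (intro bexI[of _ "UNIV - stage n"]) auto
  next
    case 2
    \<comment> \<open>A level meeting the old stage meets a slice of an old level and coincides with
      it by disjointness; otherwise it is a spacer and lies in the complement.\<close>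
    show ?thesis
    proof (cases "A \<inter> stage n = {}")
      case False
      then obtain x j where x: "x \<in> level (Suc n) p" "x \<in> level n j" "j < h n"
        using 2 by (auto simp: stage_def)
      then obtain b where "b < q n" "x \<in> level (Suc n) (pos n b + j)"
        using level_split[OF x(3)] by blast
      then have "A \<subseteq> level n j"
        using 2 x level_disjoint[OF x(1)] level_copy_subset[of b n j] by blast
      then show ?thesis using x(3) by (intro bexI[of _ "level n j"]) auto
    next
      case True
      then show ?thesis by (intro bexI[of _ "UNIV - stage n"]) auto
    qed
  qed
  then show "\<exists>B\<in>tower_partition M T (level n 0) (h n). null_subset M A B"
    unfolding tower_partition_eq space_M by (metis null_subsetI)
next
  fix B assume "B \<in> sets M"
  then have "B \<inter> support \<in> sigma_sets (space M) (\<Union>n\<in>{1..}. tower_partition M T (level n 0) (h n))"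
    using sigma_levels by simp
  moreover have "null_eq M B (B \<inter> support)"
  proof -
    have "B - B \<inter> support \<in> null_sets M"
      by (rule null_sets_subset[OF null_off_support]) (use \<open>B \<in> sets M\<close> in auto)
    moreover have "null_subset M (B \<inter> support) B" by (rule null_subsetI) blast
    ultimately show ?thesis unfolding null_eq_def null_subset_def by blast
  qed
  ultimately show "\<exists>C\<in>sigma_sets (space M) (\<Union>n\<in>{1..}. tower_partition M T (level n 0) (h n)). null_eq M B C"
    by blast
qed auto

lemma rank_one_M: "rank_one_system M T"
  unfolding rank_one_system_def
  using measure_preserving_M rank_one_parameters_h rank_one_towers_M by blast

end

section \<open>Sequence entropy of independent towers\<close>

text \<open>The interface between blocks and entropy: \<open>\<tau> n\<close> assigns to the
  positions of tower \<open>n + 1\<close> levels of tower \<open>n\<close>, extending the true ones.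
  The sets \<open>B k\<close> have one common size \<open>g\<close> because they will be label
  fibres.\<close>

locale independent_towers = cutting_and_stacking +
  fixes \<tau> :: "nat \<Rightarrow> nat \<Rightarrow> nat" and t :: "nat \<Rightarrow> nat"
  assumes \<tau>_copy: "b < q n \<Longrightarrow> j < h n \<Longrightarrow> \<tau> n (pos n b + j) = j"
    and \<tau>_less: "\<tau> n p < h n"
    and \<tau>_uniform: "\<exists>c. \<forall>j<h n. card {p. p < h (Suc n) \<and> \<tau> n p = j} = c"
    and independent: "\<exists>r N G. 2 * r + n < N \<and> G \<subseteq> {..<h (Suc n)} \<and> 7 * h (Suc n) \<le> 8 * card G \<and>
      (\<forall>p\<in>G. \<forall>k\<in>{r<..N}. p + t k < h (Suc n)) \<and>
      (\<forall>B g K. g * K = h n \<longrightarrow> (\<forall>k\<in>{r<..N}. B k \<subseteq> {..<h n} \<and> card (B k) = g) \<longrightarrow>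
        card {p\<in>G. \<forall>k\<in>{r<..N}. \<tau> n (p + t k) \<in> B k} * K ^ (N - r) = card G)"
begin

text \<open>Descent through \<open>d\<close> stages: the level of tower \<open>m\<close> attributed
  to a position of tower \<open>m + d\<close>. Spacers receive labels too, so that all fibres can
  have equal size.\<close>

primrec label :: "nat \<Rightarrow> nat \<Rightarrow> nat \<Rightarrow> nat" where
  "label m 0 p = p"
| "label m (Suc d) p = label m d (\<tau> (m + d) p)"

lemma label_less: "p < h (m + d) \<Longrightarrow> label m d p < h m"
  by (induction d arbitrary: p) (auto simp: \<tau>_less)

text \<open>A single descent has fibres of constant size, hence so has the composition. With
  \<open>K = h m\<close> this is the condition \<open>g * K = h n\<close> under which
  \<open>independent\<close> applies.\<close>

lemma label_uniform:
  "\<exists>g. g * h m = h (m + d) \<and> (\<forall>i<h m. card {p. p < h (m + d) \<and> label m d p = i} = g)"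
proof (induction d)
  case 0
  have "{p. p < h m \<and> p = i} = {i}" if "i < h m" for i using that by auto
  then show ?case by (intro exI[of _ 1]) simp
next
  case (Suc d)
  then obtain g where g: "g * h m = h (m + d)"
    "\<And>i. i < h m \<Longrightarrow> card {p. p < h (m + d) \<and> label m d p = i} = g" by blast
  obtain c where c: "\<And>j. j < h (m + d) \<Longrightarrow> card {p. p < h (Suc (m + d)) \<and> \<tau> (m + d) p = j} = c"
    using \<tau>_uniform by blast
  define S where "S j = {p. p < h (Suc (m + d)) \<and> \<tau> (m + d) p = j}" for j
  have card_UN: "card (\<Union>j\<in>J. S j) = card J * c" if "J \<subseteq> {..<h (m + d)}" for J
  proof -
    have "card (\<Union>j\<in>J. S j) = (\<Sum>j\<in>J. card (S j))"
      using that finite_subset[OF that] by (intro card_UN_disjoint) (auto simp: S_def)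
    also have "\<dots> = (\<Sum>j\<in>J. c)"
      using that c by (intro sum.cong) (auto simp: S_def)
    finally show ?thesis by simp
  qed
  have "{p. p < h (m + Suc d) \<and> label m (Suc d) p = i} = (\<Union>j\<in>{j. j < h (m + d) \<and> label m d j = i}. S j)" for i
    using \<tau>_less by (auto simp: S_def)
  then have "card {p. p < h (m + Suc d) \<and> label m (Suc d) p = i} = g * c" if "i < h m" for i
    using card_UN[of "{j. j < h (m + d) \<and> label m d j = i}"] g(2)[OF that] by auto
  moreover have "{..<h (Suc (m + d))} = (\<Union>j\<in>{..<h (m + d)}. S j)"
    using \<tau>_less by (auto simp: S_def)
  then have "h (Suc (m + d)) = h (m + d) * c"
    using card_UN[of "{..<h (m + d)}"] by (metis card_lessThan order_refl)
  ultimately show ?case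
    using g(1) by (intro exI[of _ "g * c"]) (simp add: mult.commute mult.left_commute)
qed

text \<open>By \<open>\<tau>_copy\<close>, descending from a copy returns the level that was copied,
  so refining the tower does not change the label of a point.\<close>

lemma label_later:
  assumes "x \<in> level (m + d) p" "p < h (m + d)"
  shows "\<exists>p'. x \<in> level (m + (d + k)) p' \<and> p' < h (m + (d + k)) \<and> label m (d + k) p' = label m d p"
proof (induction k)
  case 0
  show ?case using assms by auto
next
  case (Suc k)
  then obtain p' where p': "x \<in> level (m + (d + k)) p'" "p' < h (m + (d + k))" "label m (d + k) p' = label m d p"
    by blast
  obtain b where b: "b < q (m + (d + k))" "x \<in> level (Suc (m + (d + k))) (pos (m + (d + k)) b + p')"
    using p'(1) level_split[OF p'(2)] by auto
  show ?case
    using b p' pos_add_less[OF b(1) p'(2)] \<tau>_copy[OF b(1) p'(2)]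
    by (intro exI[of _ "pos (m + (d + k)) b + p'"]) simp
qed

lemma label_consistent:
  assumes "x \<in> level (m + d) p" "p < h (m + d)" "x \<in> level (m + d') p'" "p' < h (m + d')"
  shows "label m d p = label m d' p'"
proof -
  obtain r where r: "x \<in> level (m + (d + d')) r" "label m (d + d') r = label m d p"
    using label_later[OF assms(1,2), of d'] by blast
  obtain r' where r': "x \<in> level (m + (d' + d)) r'" "label m (d' + d) r' = label m d' p'"
    using label_later[OF assms(3,4), of d] by blast
  have "r = r'" using r(1) r'(1) level_disjoint by (metis add.commute)
  then show ?thesis using r(2) r'(2) by (simp add: add.commute)
qed

text \<open>A point is classified as soon as some tower from stage \<open>m\<close> on contains it.
  Cell \<open>0\<close> also takes the null complement of the support, so that the cells partition
  the space exactly.\<close>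

definition cell :: "nat \<Rightarrow> nat \<Rightarrow> real set" where
  "cell m i = (\<Union>d. \<Union>p\<in>{p. p < h (m + d) \<and> label m d p = i}. level (m + d) p) \<union>
     (if i = 0 then - support else {})"

lemma cell_measurable [measurable]: "cell m i \<in> sets borel"
proof -
  have "- support \<in> sets borel"
    using sets.Diff[of UNIV borel support] by (simp add: Compl_eq_Diff_UNIV)
  then show ?thesis
    unfolding cell_def by (intro sets.Un sets.countable_UN' level_measurable) auto
qed

lemma in_cell_iff:
  assumes "x \<in> level (m + d) p" "p < h (m + d)"
  shows "x \<in> cell m i \<longleftrightarrow> label m d p = i"
proof
  assume "x \<in> cell m i"
  moreover have "x \<in> support" using assms level_subset_support by blast
  ultimately obtain d' p' where "p' < h (m + d')" "label m d' p' = i" "x \<in> level (m + d') p'"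
    by (auto simp: cell_def split: if_splits)
  then show "label m d p = i" using label_consistent[OF assms] by metis
next
  assume "label m d p = i"
  then show "x \<in> cell m i" using assms by (auto simp: cell_def)
qed

lemma ex1_cell: "\<exists>!i. i < h m \<and> x \<in> cell m i"
proof (cases "x \<in> support")
  case True
  then obtain n p where np: "x \<in> level n p" "p < h n" by (auto simp: support_def stage_def)
  obtain p' where "x \<in> level (m + n) p'" "p' < h (m + n)"
    using level_later[OF np, of "m + n"] by auto
  then show ?thesis using in_cell_iff[of x m n p'] label_less[of p' m n] by auto
next
  case False
  then have "x \<in> cell m i \<longleftrightarrow> i = 0" for i
    using level_subset_support by (auto simp: cell_def)
  then show ?thesis using h_pos[of m] by auto
qed

section \<open>Entropy of the joins of the cells\<close>

definition cells :: "nat \<Rightarrow> real set set" where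
  "cells m = cell m ` {..<h m}"

lemma cells_partition: "finite_measurable_partition M (cells m)"
  unfolding finite_measurable_partition_def
proof (intro conjI partition_onI)
  show "\<Union> (cells m) = space M"
    using ex1_cell[of m] unfolding cells_def by (simp add: set_eq_iff Bex_def) metis
  show "disjnt A B" if "A \<in> cells m" "B \<in> cells m" "A \<noteq> B" for A B
    using that ex1_cell[of m] unfolding cells_def disjnt_iff by blast
  show "{} \<notin> cells m"
  proof
    assume "{} \<in> cells m"
    then obtain i where i: "i < h m" "cell m i = {}" by (auto simp: cells_def)
    have "left m i \<in> level (m + 0) i" by (simp add: level_def)
    then show False using in_cell_iff[of "left m i" m 0 i i] i by simp
  qed
qed (auto simp: cells_def)

lemma pullback_partition_on:
  assumes "partition_on UNIV \<xi>"
  shows "partition_on UNIV (pullback_partition M T j \<xi>)"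
proof -
  show ?thesis
  proof (rule partition_onI)
    show "\<Union> (pullback_partition M T j \<xi>) = UNIV"
      using partition_onD1[OF assms] by (auto simp: pullback_partition_def set_eq_iff)
    show "disjnt A B"
      if AB: "A \<in> pullback_partition M T j \<xi>" "B \<in> pullback_partition M T j \<xi>" "A \<noteq> B" for A B
    proof -
      obtain A' B' where "A = (T ^^ j) -` A'" "B = (T ^^ j) -` B'" "A' \<in> \<xi>" "B' \<in> \<xi>"
        using AB(1,2) by (auto simp: pullback_partition_def)
      moreover from this have "A' \<inter> B' = {}"
        using AB(3) disjointD[OF partition_onD2[OF assms]] by metis
      ultimately show ?thesis unfolding disjnt_def by blast
    qed
    have "surj (T ^^ j)" using bij_T by (simp add: bij_is_surj bij_betw_funpow)
    then have "(T ^^ j) -` B \<noteq> {}" if "B \<noteq> {}" for B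
      using that surj_vimage_empty by metis
    then show "{} \<notin> pullback_partition M T j \<xi>"
      using partition_onD3[OF assms] by (auto simp: pullback_partition_def) metis
  qed
qed

lemma common_refinement_cells:
  fixes m N :: nat
  assumes "1 \<le> N"
  defines "P \<equiv> common_refinement ((\<lambda>k. pullback_partition M T (t k) (cells m)) ` {1..N})"
  shows "finite P" "P \<subseteq> sets M" "partition_on UNIV P"
    and "A \<in> P \<Longrightarrow> \<exists>i. \<forall>k\<in>{1..N}. i k < h m \<and> A \<subseteq> (T ^^ t k) -` cell m (i k)"
proof -
  have part: "partition_on UNIV (cells m)"
    using cells_partition[of m] by (simp add: finite_measurable_partition_def)
  show "partition_on UNIV P"
    unfolding P_def using assms(1) pullback_partition_on[OF part]
    by (intro partition_on_common_refinement) auto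
  show "finite P"
    unfolding P_def by (intro finite_common_refinement) (auto simp: pullback_partition_def cells_def)
  have "(T ^^ j) -` cell m i \<in> sets borel" for i j
  proof -
    have "T ^^ j \<in> borel_measurable borel"
      using T_measurable by (induction j) (auto intro: measurable_comp simp: id_def)
    then show ?thesis using measurable_sets[of "T ^^ j" borel borel "cell m i"] by simp
  qed
  then have "pullback_partition M T j (cells m) \<subseteq> sets borel" for j
    by (auto simp: pullback_partition_def cells_def)
  then show "P \<subseteq> sets M"
    unfolding P_def common_refinement_def using assms(1)
    by (auto intro!: sets.finite_INT simp: PiE_iff)
  assume A: "A \<in> P"
  have "\<exists>i. i < h m \<and> A \<subseteq> (T ^^ t k) -` cell m i" if k: "k \<in> {1..N}" for k
  proof -
    have "\<exists>R\<in>pullback_partition M T (t k) (cells m). A \<subseteq> R"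
      using A k unfolding P_def by (intro common_refinement_exists) auto
    then show ?thesis by (auto simp: pullback_partition_def cells_def)
  qed
  then show "\<exists>i. \<forall>k\<in>{1..N}. i k < h m \<and> A \<subseteq> (T ^^ t k) -` cell m (i k)"
    by metis
qed

text \<open>An atom of the join prescribes a cell at every time. At good positions the cells after
  time \<open>r\<close> are labels of independent virtual levels, so with \<open>K = h m\<close> the
  atom has mass at most \<open>1 / K ^ (N - r)\<close> there, and the entropy bound for such
  partitions applies.\<close>

lemma entropy_cells_ge:
  assumes m: "2 \<le> h m" and large: "6 / 7 \<le> real (h (Suc (m + d))) * width (Suc (m + d)) / total"
  shows "\<exists>N>d. ln (real (h m)) / 4 - 1 \<le> 1 / real N *
    partition_entropy M (common_refinement ((\<lambda>k. pullback_partition M T (t k) (cells m)) ` {1..N}))"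
proof -
  define n where "n = m + d"
  define K where "K = h m"
  obtain r N G where N: "2 * r + n < N" and G: "G \<subseteq> {..<h (Suc n)}" "7 * h (Suc n) \<le> 8 * card G"
    and inside: "\<forall>p\<in>G. \<forall>k\<in>{r<..N}. p + t k < h (Suc n)"
    and count: "\<forall>B g K. g * K = h n \<longrightarrow> (\<forall>k\<in>{r<..N}. B k \<subseteq> {..<h n} \<and> card (B k) = g) \<longrightarrow>
        card {p\<in>G. \<forall>k\<in>{r<..N}. \<tau> n (p + t k) \<in> B k} * K ^ (N - r) = card G"
    using independent[of n] by (elim exE conjE) (rule that)
  obtain g where g: "g * K = h n" "\<And>i. i < K \<Longrightarrow> card {j. j < h n \<and> label m d j = i} = g"
    using label_uniform[of m d] unfolding n_def K_def by blast
  define P where "P = common_refinement ((\<lambda>k. pullback_partition M T (t k) (cells m)) ` {1..N})"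
  have "1 \<le> N" using N by simp
  note P = common_refinement_cells[where m = m, OF this, folded P_def]
  define E where "E = (\<Union>p\<in>G. level (Suc n) p)"
  define \<delta> where "\<delta> = 1 / real K ^ (N - r)"
  have "real 2 \<le> real (K ^ (N - r))"
    using m N power_increasing[of 1 "N - r" K] unfolding K_def of_nat_le_iff by (simp add: Suc_le_eq)
  then have \<delta>: "0 < \<delta>" "2 * \<delta> \<le> 1"
    using m by (simp_all add: \<delta>_def K_def divide_le_eq)
  have all_le: "real (h (Suc n)) * width (Suc n) / total \<le> 1"
    using prob_levels[of "{..<h (Suc n)}" "Suc n"] prob_le_1 by (metis card_lessThan order_refl)
  have "partition_entropy M P \<ge> ln (1 / (2 * \<delta>)) / 2"
  proof (rule partition_entropy_ge[OF prob_space_M P(1,2)])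
    show "partition_on (space M) P" using P(3) by simp
    show "E \<in> sets M"
      unfolding E_def using finite_subset[OF G(1)] by (auto intro: sets.finite_UN)
    \<comment> \<open>At least 7/8 of the positions are good, and the tower carries at least 6/7 of
      the mass.\<close>
    have "3 / 4 = (7 / 8) * (6 / 7 :: real)" by simp
    also have "\<dots> \<le> (7 / 8) * (real (h (Suc n)) * width (Suc n) / total)"
      using large unfolding n_def by (intro mult_left_mono) auto
    also have "\<dots> = (7 * real (h (Suc n)) / 8) * (width (Suc n) / total)" by simp
    also have "\<dots> \<le> real (card G) * (width (Suc n) / total)"
      using G(2) total_ge_1 by (intro mult_right_mono) (auto simp: less_imp_le)
    also have "\<dots> = prob E"
      unfolding E_def by (simp add: prob_levels[OF G(1)])
    finally show "3 / 4 \<le> prob E" .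
  next
    fix A assume "A \<in> P"
    from P(4)[OF this] obtain i where i: "\<forall>k\<in>{1..N}. i k < h m \<and> A \<subseteq> (T ^^ t k) -` cell m (i k)"
      by (elim exE) (rule that)
    \<comment> \<open>A label over \<open>Suc d\<close> stages factors through
      \<open>\<tau> n\<close>, so prescribing cells restricts \<open>\<tau> n\<close> to label
      fibres, all of size \<open>g\<close>.\<close>
    define G' where "G' = {p\<in>G. \<forall>k\<in>{r<..N}. \<tau> n (p + t k) \<in> {j. j < h n \<and> label m d j = i k}}"
    have "A \<inter> E \<subseteq> (\<Union>p\<in>G'. level (Suc n) p)"
    proof
      fix x assume x: "x \<in> A \<inter> E"
      then obtain p where p: "p \<in> G" "x \<in> level (Suc n) p" by (auto simp: E_def)
      have "label m d (\<tau> n (p + t k)) = i k" if k: "k \<in> {r<..N}" for k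
      proof -
        have "(T ^^ t k) x \<in> level (Suc n) (p + t k)"
          using T_pow_in_level[OF inside[rule_format, OF p(1) k] p(2)] .
        moreover have "(T ^^ t k) x \<in> cell m (i k)"
          using bspec[OF i, of k] k x by auto
        ultimately have "label m (Suc d) (p + t k) = i k"
          using in_cell_iff[of _ m "Suc d"] inside[rule_format, OF p(1) k] by (simp add: n_def)
        then show ?thesis by (simp add: n_def)
      qed
      then have "p \<in> G'" using p(1) \<tau>_less by (simp add: G'_def)
      then show "x \<in> (\<Union>p\<in>G'. level (Suc n) p)" using p(2) by blast
    qed
    moreover have G': "G' \<subseteq> {..<h (Suc n)}" using G(1) by (auto simp: G'_def)
    moreover have "(\<Union>p\<in>G'. level (Suc n) p) \<in> events"
      using finite_subset[OF G'] by (auto intro: sets.finite_UN)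
    ultimately have "prob (A \<inter> E) \<le> real (card G') * width (Suc n) / total"
      using finite_measure_mono prob_levels by metis
    also have "card G' * K ^ (N - r) = card G"
      unfolding G'_def using i g(2) by (intro count[rule_format, OF g(1)]) (auto simp: K_def)
    then have "real (card G') * real K ^ (N - r) \<le> real (h (Suc n))"
      using card_mono[OF _ G(1)] by (metis card_lessThan finite_lessThan of_nat_le_iff of_nat_mult of_nat_power)
    then have "real (card G') \<le> real (h (Suc n)) * \<delta>"
      using m by (simp add: \<delta>_def K_def pos_le_divide_eq)
    then have "real (card G') * width (Suc n) / total \<le> (real (h (Suc n)) * \<delta>) * width (Suc n) / total"
      using total_ge_1 by (intro divide_right_mono mult_right_mono) (auto simp: less_imp_le)
    also have "\<dots> = (real (h (Suc n)) * width (Suc n) / total) * \<delta>" by simp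
    also have "\<dots> \<le> 1 * \<delta>" using all_le \<delta> by (intro mult_right_mono) auto
    finally show "prob (A \<inter> E) \<le> \<delta>" by simp
  qed (fact \<delta>)+
  moreover have "real N * (ln (real K) / 4 - 1) \<le> ln (1 / (2 * \<delta>)) / 2"
  proof -
    have "ln (1 / (2 * \<delta>)) = real (N - r) * ln (real K) - ln 2"
      using m by (simp add: \<delta>_def K_def ln_div ln_realpow)
    moreover have "real N / 2 * ln (real K) \<le> real (N - r) * ln (real K)"
      using m N by (intro mult_right_mono) (auto simp: K_def of_nat_diff)
    moreover have "ln 2 \<le> 2 * real N" using ln_2_less_1 \<open>1 \<le> N\<close> by linarith
    ultimately show ?thesis by (simp add: algebra_simps)
  qed
  ultimately have "ln (real K) / 4 - 1 \<le> 1 / real N * partition_entropy M P"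
    using \<open>1 \<le> N\<close> by (simp add: pos_le_divide_eq mult.commute)
  moreover have "d < N" using N by (simp add: n_def)
  ultimately show ?thesis unfolding P_def K_def by blast
qed

text \<open>One good \<open>N\<close> beyond every \<open>d\<close> is enough for a limsup: it
  refutes any eventual smaller bound. Taking \<open>d\<close> large also makes the tower fill more
  than 6/7 of the space.\<close>

lemma seq_entropy_cells_ge:
  assumes "2 \<le> h m"
  shows "seq_entropy_partition t M T (cells m) \<ge> ereal (ln (real (h m)) / 4 - 1)"
proof (rule ccontr)
  assume "\<not> ?thesis"
  then have "\<forall>\<^sub>F N in sequentially. ereal (1 / real N * partition_entropy M (common_refinement
      ((\<lambda>k. pullback_partition M T (t k) (cells m)) ` {1..N}))) < ereal (ln (real (h m)) / 4 - 1)"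
    unfolding not_le seq_entropy_partition_def by (rule Limsup_lessD)
  then obtain N0 where N0: "\<And>N. N0 \<le> N \<Longrightarrow> 1 / real N * partition_entropy M (common_refinement
      ((\<lambda>k. pullback_partition M T (t k) (cells m)) ` {1..N})) < ln (real (h m)) / 4 - 1"
    unfolding eventually_sequentially by auto
  have "(\<lambda>n. real (h n) * width n / total) \<longlonglongrightarrow> total / total"
    using stage_tendsto_total total_ge_1 by (intro tendsto_divide) auto
  then have "\<forall>\<^sub>F n in sequentially. 6 / 7 < real (h n) * width n / total"
    using total_ge_1 by (intro order_tendstoD) auto
  then obtain n0 where n0: "\<And>n. n0 \<le> n \<Longrightarrow> 6 / 7 < real (h n) * width n / total"
    unfolding eventually_sequentially by blast
  define d where "d = n0 + N0"
  obtain N where "d < N" "ln (real (h m)) / 4 - 1 \<le> 1 / real N * partition_entropy M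
      (common_refinement ((\<lambda>k. pullback_partition M T (t k) (cells m)) ` {1..N}))"
    using entropy_cells_ge[OF assms, of d] n0[of "Suc (m + d)"] by (auto simp: d_def)
  then show False using N0[of N] by (simp add: d_def)
qed

lemma seq_entropy_M: "seq_entropy t M T = \<infinity>"
proof (rule ereal_top)
  fix B :: real
  obtain m where m: "exp (4 * (B + 1)) + 2 \<le> real m" using real_arch_simple by blast
  have "m \<le> h m" using strict_mono_h by (rule strict_mono_imp_increasing)
  then have hm: "exp (4 * (B + 1)) + 2 \<le> real (h m)" using m by linarith
  then have "2 \<le> h m" using exp_gt_zero[of "4 * (B + 1)"] by linarith
  have "4 * (B + 1) \<le> ln (real (h m))"
    using hm \<open>2 \<le> h m\<close> by (subst ln_ge_iff) auto
  then have "ereal B \<le> ereal (ln (real (h m)) / 4 - 1)" by simp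
  also have "\<dots> \<le> seq_entropy_partition t M T (cells m)"
    using \<open>2 \<le> h m\<close> by (rule seq_entropy_cells_ge)
  also have "\<dots> \<le> seq_entropy t M T"
    unfolding seq_entropy_def using cells_partition by (intro SUP_upper) auto
  finally show "ereal B \<le> seq_entropy t M T" .
qed

end

section \<open>The block construction\<close>

locale block_stage =
  fixes c h Q :: nat and s :: "nat \<Rightarrow> nat"
  assumes c_pos: "0 < c" and h_gt_0: "0 < h" and s_0: "s 0 = 0" and s_Q: "s Q = 0"
    and s_less: "s J < h"
begin

text \<open>Copy \<open>b\<close> is number \<open>b mod c\<close> of block \<open>b div c\<close>.
  The closing copy is \<open>b = Q * c\<close>, formally the first one of block \<open>Q\<close>;
  \<open>s Q = 0\<close> puts it directly behind the last block.\<close>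

definition start :: "nat \<Rightarrow> nat" where
  "start b = (b div c) * ((c + 1) * h) + s (b div c) + (b mod c) * h"

lemma start_0: "start 0 = 0"
  by (simp add: start_def s_0)

lemma start_last: "start (Q * c) = Q * ((c + 1) * h)"
  using c_pos by (simp add: start_def s_Q)

lemma start_Suc: "start b + h \<le> start (Suc b)"
proof (cases "Suc (b mod c) = c")
  case True
  \<comment> \<open>Across a block boundary the gap consists of the spacers closing the block and
    the next shift; it is non-negative because shifts are below \<open>h\<close>.\<close>
  then have "(b mod c) * h + h = c * h" by (metis add.commute mult_Suc)
  then show ?thesis
    using True less_imp_le[OF s_less[of "b div c"]] by (simp add: start_def div_Suc mod_Suc algebra_simps)
next
  case False
  then show ?thesis by (simp add: start_def div_Suc mod_Suc)
qed

text \<open>On a genuine copy the shift cancels modulo \<open>h\<close>. Since it is below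
  \<open>h\<close>, the shifted copies stay inside their block and the block index is read off
  correctly.\<close>

lemma virtual_level_start:
  assumes "j < h"
  shows "virtual_level h ((c + 1) * h) s (start b + j) = j"
proof -
  define J i where "J = b div c" and "i = b mod c"
  have eq: "start b + j = (s J + i * h + j) + J * ((c + 1) * h)"
    by (simp add: start_def J_def i_def)
  have "i * h + h \<le> c * h"
    using mod_less_divisor[OF c_pos, of b] mult_le_mono1[of "Suc i" c h] by (simp add: i_def)
  then have "s J + i * h + j < (c + 1) * h" using assms s_less[of J] by simp
  then have J: "(start b + j) div ((c + 1) * h) = J"
    unfolding eq using h_gt_0 by (subst div_mult_self1) auto
  have "start b + j + h - s J = j + (J * (c + 1) + i + 1) * h"
    unfolding eq by (simp add: algebra_simps)
  then have "(start b + j + h - s J) mod h = j mod h"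
    by (simp only: mod_mult_self1)
  then show ?thesis
    unfolding virtual_level_def J using assms by simp
qed

text \<open>Cut the tower into rows of length \<open>h\<close>: the shift is constant on each row, so every virtual
  level occurs exactly once in it.\<close>

lemma card_virtual_level:
  assumes j: "j < h"
  shows "card {p. p < Q * ((c + 1) * h) + h \<and> virtual_level h ((c + 1) * h) s p = j} = Q * (c + 1) + 1"
proof -
  \<comment> \<open>The only position of row \<open>a\<close> with virtual level \<open>j\<close>.
    Each block has \<open>c + 1\<close> rows, and the closing copy is one more.\<close>
  define f where "f a = (j + s (a div (c + 1))) mod h + a * h" for a
  have f_div: "f a div h = a" and f_mod: "f a mod h = (j + s (a div (c + 1))) mod h" for a
    using h_gt_0 by (simp_all add: f_def)
  have vl: "virtual_level h ((c + 1) * h) s p = (p mod h + h - s (p div h div (c + 1))) mod h" for p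
  proof -
    have "p + h - s (p div h div (c + 1)) = (p mod h + h - s (p div h div (c + 1))) + (p div h) * h"
      using s_less[of "p div h div (c + 1)"] div_mult_mod_eq[of p h] by linarith
    then show ?thesis
      unfolding virtual_level_def mult.commute[of "c + 1" h] div_mult2_eq by simp
  qed
  have solve: "(y + h - \<sigma>) mod h = j \<longleftrightarrow> y = (j + \<sigma>) mod h" if "y < h" "\<sigma> < h" for y \<sigma>
  proof (cases "\<sigma> \<le> y")
    case True
    then have "(y + h - \<sigma>) mod h = y - \<sigma>"
      using that by (metis Nat.add_diff_assoc2 less_imp_diff_less mod_add_self2 mod_less)
    then show ?thesis
      using True that j by (auto simp: mod_if)
  next
    case False
    then have "(y + h - \<sigma>) mod h = y + h - \<sigma>" using that by (intro mod_less) auto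
    then show ?thesis
      using False that j by (auto simp: mod_if)
  qed
  have "{p. p < Q * ((c + 1) * h) + h \<and> virtual_level h ((c + 1) * h) s p = j} = f ` {..<Q * (c + 1) + 1}"
  proof (intro equalityI subsetI)
    fix p assume p: "p \<in> {p. p < Q * ((c + 1) * h) + h \<and> virtual_level h ((c + 1) * h) s p = j}"
    then have "(p mod h + h - s (p div h div (c + 1))) mod h = j"
      unfolding vl by blast
    then have "p mod h = (j + s (p div h div (c + 1))) mod h"
      using solve[of "p mod h" "s (p div h div (c + 1))"] h_gt_0 s_less by simp
    then have "p = f (p div h)" unfolding f_def using div_mult_mod_eq[of p h] by linarith
    moreover have "p < (Q * (c + 1) + 1) * h" using p by (simp add: algebra_simps)
    then have "p div h < Q * (c + 1) + 1" by (rule less_mult_imp_div_less)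
    ultimately show "p \<in> f ` {..<Q * (c + 1) + 1}" by blast
  next
    fix p assume "p \<in> f ` {..<Q * (c + 1) + 1}"
    then obtain a where a: "a < Q * (c + 1) + 1" "p = f a" by blast
    have "f a < (a + 1) * h" using h_gt_0 by (simp add: f_def)
    also have "\<dots> \<le> (Q * (c + 1) + 1) * h" using a(1) by (intro mult_le_mono1) simp
    finally have "p < Q * ((c + 1) * h) + h" using a(2) by (simp add: algebra_simps)
    moreover have "virtual_level h ((c + 1) * h) s p = j"
      unfolding vl a(2) f_div f_mod using solve h_gt_0 s_less by simp
    ultimately show "p \<in> {p. p < Q * ((c + 1) * h) + h \<and> virtual_level h ((c + 1) * h) s p = j}" by simp
  qed
  moreover have "inj f" by (rule inj_on_inverseI[of _ "\<lambda>p. p div h"]) (rule f_div)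
  ultimately show ?thesis by (simp add: card_image inj_on_subset)
qed

end

theorem theorem1p2:
  fixes t :: "nat \<Rightarrow> nat"
  assumes "filterlim (\<lambda>n. int (t (Suc n)) - int (t n)) at_top sequentially"
  shows "\<exists>(M :: real measure) T. rank_one_system M T \<and> seq_entropy t M T = \<infinity>"
proof -
  define good where "good n h Q s \<longleftrightarrow> 0 < Q \<and> s 0 = 0 \<and> s Q = 0 \<and> (\<forall>J. s J < h) \<and>
    (\<exists>r N G. 2 * r + n < N \<and> G \<subseteq> {..<Q * ((2 ^ n + 1) * h) + h} \<and>
      7 * (Q * ((2 ^ n + 1) * h) + h) \<le> 8 * card G \<and>
      (\<forall>p\<in>G. \<forall>k\<in>{r<..N}. p + t k < Q * ((2 ^ n + 1) * h) + h) \<and>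
      (\<forall>B g K. g * K = h \<longrightarrow> (\<forall>k\<in>{r<..N}. B k \<subseteq> {..<h} \<and> card (B k) = g) \<longrightarrow>
        card {p\<in>G. \<forall>k\<in>{r<..N}. virtual_level h ((2 ^ n + 1) * h) s (p + t k) \<in> B k} * K ^ (N - r) = card G))"
    for n h Q :: nat and s :: "nat \<Rightarrow> nat"
  have "\<exists>Q s. 0 < h \<longrightarrow> good n h Q s" for n h
  proof (cases "0 < h")
    case True
    have "0 < (2 :: nat) ^ n + 1" by simp
    from ex_independent_shifts[OF assms True refl this, of n] obtain Q s where "good n h Q s"
      unfolding good_def by (elim exE) blast
    then show ?thesis by blast
  qed simp
  \<comment> \<open>The choice is made for every conceivable height, because the actual heights only
    arise from the recursion that uses it.\<close>
  then have "\<forall>n h. \<exists>Q s. 0 < h \<longrightarrow> good n h Q s" by blast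
  then obtain Q s where Qs: "\<And>n h. 0 < h \<Longrightarrow> good n h (Q n h) (s n h)"
    unfolding choice_iff by blast
  define h where "h = rec_nat 1 (\<lambda>n hn. Q n hn * ((2 ^ n + 1) * hn) + hn)"
  define l where "l n = (2 ^ n + 1) * h n" for n
  define q where "q n = Q n (h n) * 2 ^ n + 1" for n
  define S where "S n = s n (h n)" for n
  have h_0: "h 0 = 1" and h_Suc: "h (Suc n) = Q n (h n) * l n + h n" for n
    by (simp_all add: h_def l_def)
  have h_pos: "0 < h n" for n by (induction n) (simp_all add: h_0 h_Suc)
  have good: "good n (h n) (Q n (h n)) (S n)" for n using Qs[OF h_pos] by (simp add: S_def)
  have stage: "block_stage (2 ^ n) (h n) (Q n (h n)) (S n)" for n
    using good[of n] h_pos[of n] by (simp add: block_stage_def good_def)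
  define pos where "pos n = block_stage.start (2 ^ n) (h n) (S n)" for n
  \<comment> \<open>A block has \<open>h n\<close> spacers for \<open>2 ^ n\<close> copies, so the
    height grows at most by the factor \<open>q n * (1 + 1 / 2 ^ n)\<close>, which is at most
    \<open>q n * exp (1 / 2 ^ n)\<close>. The exponent \<open>2 - 2 / 2 ^ n\<close> is the sum of
    \<open>1 / 2 ^ m\<close> over \<open>m < n\<close>.\<close>
  have bound: "real (h n) \<le> exp (2 - 2 / 2 ^ n) * (\<Prod>m<n. real (q m))" for n
  proof (induction n)
    case (Suc n)
    have "real (h (Suc n)) \<le> real (q n) * (1 + 1 / 2 ^ n) * real (h n)"
      by (simp add: h_Suc l_def q_def field_simps)
    also have "\<dots> \<le> real (q n) * exp (1 / 2 ^ n) * real (h n)"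
      by (intro mult_right_mono mult_left_mono exp_ge_add_one_self) auto
    also have "\<dots> \<le> real (q n) * exp (1 / 2 ^ n) * (exp (2 - 2 / 2 ^ n) * (\<Prod>m<n. real (q m)))"
      using Suc by (intro mult_left_mono) auto
    also have "\<dots> = (exp (1 / 2 ^ n) * exp (2 - 2 / 2 ^ n)) * (\<Prod>m<Suc n. real (q m))"
      by (simp only: prod.lessThan_Suc mult_ac)
    also have "exp (1 / 2 ^ n) * exp (2 - 2 / 2 ^ n) = exp (2 - 2 / 2 ^ Suc n :: real)"
      unfolding exp_add[symmetric] by (simp add: field_simps)
    finally show ?case .
  qed (simp add: h_0)
  interpret independent_towers h q pos "\<lambda>n. virtual_level (h n) (l n) (S n)" t
  proof
    fix n
    interpret block_stage "2 ^ n" "h n" "Q n (h n)" "S n" by (rule stage)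
    show "2 \<le> q n" using good[of n] by (simp add: q_def good_def Suc_le_eq)
    show "pos n 0 = 0" by (simp add: pos_def start_0)
    show "pos n b + h n \<le> pos n (Suc b)" for b by (simp add: pos_def start_Suc)
    show "pos n (q n - 1) + h n = h (Suc n)"
      using start_last by (simp add: pos_def q_def h_Suc l_def)
    show "virtual_level (h n) (l n) (S n) (pos n b + j) = j" if "j < h n" for b j
      using virtual_level_start[OF that] by (simp add: pos_def l_def)
    show "virtual_level (h n) (l n) (S n) p < h n" for p
      using h_pos[of n] by (simp add: virtual_level_def)
    show "\<exists>c. \<forall>j<h n. card {p. p < h (Suc n) \<and> virtual_level (h n) (l n) (S n) p = j} = c"
      using card_virtual_level unfolding h_Suc l_def by blast
    show "\<exists>r N G. 2 * r + n < N \<and> G \<subseteq> {..<h (Suc n)} \<and> 7 * h (Suc n) \<le> 8 * card G \<and>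
      (\<forall>p\<in>G. \<forall>k\<in>{r<..N}. p + t k < h (Suc n)) \<and>
      (\<forall>B g K. g * K = h n \<longrightarrow> (\<forall>k\<in>{r<..N}. B k \<subseteq> {..<h n} \<and> card (B k) = g) \<longrightarrow>
        card {p\<in>G. \<forall>k\<in>{r<..N}. virtual_level (h n) (l n) (S n) (p + t k) \<in> B k} * K ^ (N - r) = card G)"
      using good[of n] unfolding good_def h_Suc l_def by blast
  next
    show "0 < h 0" by (rule h_pos)
    have "real (h n) \<le> exp 2 * (\<Prod>m<n. real (q m))" for n
      using bound[of n] by (rule order_trans) (auto intro!: mult_right_mono prod_nonneg)
    then show "\<exists>C. \<forall>n. real (h n) \<le> C * (\<Prod>m<n. real (q m))" by blast
  qed
  show ?thesis
    using rank_one_M seq_entropy_M by blast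
qed

end
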